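(* Let $s>0$, $\omega\in\mathbb{R}\setminus\mathbb{Q}$, $\lambda=e^{2\pi i\omega}$, and let $(q_k)_{k\ge0}$ be the denominators of the convergents of $\omega$. (i) The operator $\delta_\lambda$, $(\delta_\lambda f)(z)=\sum_{n=2}^\infty(\lambda^n-\lambda)f_nz^n$, acts linearly on $zA_s$, and it is a linear automorphism of $zA_s$ if and only if $$\lim_{k\to\infty}\frac{\log q_{k+1}}{q_k\log q_k}=0.$$ (ii) Let $F\in A_s$ with $F'(0)=\lambda$. If $$\lim_{k\to\infty}\frac{1}{\log q_k}\sum_{i=0}^{k}\frac{\log q_{i+1}}{q_i}=0,$$ then the linearization $H_F$ of $F$ also belongs to $A_s$.
   Context: For $s'>0$, $z\mathbb{C}[[z]]_{s'}$ is the algebra of Gevrey-$s'$ series: those $f=\sum_{n\ge1}f_nz^n$ for which there exist $c_1,c_2>0$ with $|f_n|\le c_1c_2^n(n!)^{s'}$ for all $n\ge1$. Put $A_s=\bigcap_{s'>s}z\mathbb{C}[[z]]_{s'}$; equivalently, $A_s$ is the set of $f=\sum_{n\ge1}f_nz^n\in z\mathbb{C}[[z]]$ with $\limsup_{n\to\infty}\frac{\log|f_n|}{n\log n}\le s$. The space $zA_s=\{zf: f\in A_s\}$ consists of formal series whose coefficient of $z$ is zero; an element of it is written $f=\sum_{n\ge2}f_nz^n$. For $F\in z\mathbb{C}[[z]]$ with $F'(0)=\lambda=e^{2\pi i\omega}$, $\omega$ irrational, the linearization $H_F$ is the unique formal series $H_F=z+\sum_{n\ge2}h_nz^n$ satisfying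 $F\circ H_F=H_F\circ R_\lambda$, where $R_\lambda(z)=\lambda z$. Continued fractions: $a_0=\lfloor\omega\rfloor$, $\omega_0=\omega-\lfloor\omega\rfloor$, and for $n\ge1$, $a_n=\lfloor 1/\omega_{n-1}\rfloor$, $\omega_n=1/\omega_{n-1}-a_n$; the denominators of the convergents are given by $q_{-2}=1$, $q_{-1}=0$, $q_n=a_nq_{n-1}+q_{n-2}$ for $n\ge0$. *)

theory Defs
  imports "HOL-Analysis.Analysis" "HOL-Computational_Algebra.Formal_Power_Series"
begin

definition gevrey :: "real \<Rightarrow> complex fps set" where
  "gevrey s = {f. fps_nth f 0 = 0 \<and>
     (\<exists>c1>0. \<exists>c2>0. \<forall>n\<ge>1. norm (fps_nth f n) \<le> c1 * c2 ^ n * (fact n :: real) powr s)}"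

definition A_class :: "real \<Rightarrow> complex fps set" where
  "A_class s = (\<Inter>s'\<in>{s<..}. gevrey s')"

definition zA_class :: "real \<Rightarrow> complex fps set" where
  "zA_class s = (\<lambda>f. fps_X * f) ` A_class s"

interpretation fps_vs: vector_space "\<lambda>(c::complex) f. fps_const c * f"
  by unfold_locales (simp_all add: algebra_simps flip: fps_const_add fps_const_mult)

text \<open>The complex linear structure on formal series is \<^term>\<open>\<lambda>(c::complex) f. fps_const c * f\<close>;
  linearity is only required on the subspace.\<close>

definition acts_linearly_on :: "(complex fps \<Rightarrow> complex fps) \<Rightarrow> complex fps set \<Rightarrow> bool" where
  "acts_linearly_on T V \<longleftrightarrow>
     fps_vs.subspace V \<and> (\<forall>f\<in>V. T f \<in> V) \<and>
     (\<forall>f\<in>V. \<forall>g\<in>V. T (f + g) = T f + T g) \<and>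
     (\<forall>c. \<forall>f\<in>V. T (fps_const c * f) = fps_const c * T f)"

definition linear_automorphism_on :: "(complex fps \<Rightarrow> complex fps) \<Rightarrow> complex fps set \<Rightarrow> bool" where
  "linear_automorphism_on T V \<longleftrightarrow> acts_linearly_on T V \<and> bij_betw T V V"

definition delta_op :: "complex \<Rightarrow> complex fps \<Rightarrow> complex fps" where
  "delta_op l f = Abs_fps (\<lambda>n. if n \<ge> 2 then (l ^ n - l) * fps_nth f n else 0)"

text \<open>\<open>H\<close> is normalized (\<open>H = z + \<dots>\<close>) and conjugates \<open>F\<close> to the rotation by \<open>F'(0)\<close>.\<close>

definition is_linearization :: "complex fps \<Rightarrow> complex fps \<Rightarrow> bool" where
  "is_linearization F H \<longleftrightarrow> fps_nth H 0 = 0 \<and> fps_nth H 1 = 1 \<and>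
     fps_compose F H = fps_compose H (fps_const (fps_nth (fps_deriv F) 0) * fps_X)"

text \<open>Well defined for irrational rotation number, see \<open>linearization_ex1\<close> below.\<close>

definition linearization :: "complex fps \<Rightarrow> complex fps" where
  "linearization F = (THE H. is_linearization F H)"

fun cf_rem :: "real \<Rightarrow> nat \<Rightarrow> real" where
  "cf_rem w 0 = w - of_int \<lfloor>w\<rfloor>"
| "cf_rem w (Suc n) = 1 / cf_rem w n - of_int \<lfloor>1 / cf_rem w n\<rfloor>"

fun cf_coeff :: "real \<Rightarrow> nat \<Rightarrow> int" where
  "cf_coeff w 0 = \<lfloor>w\<rfloor>"
| "cf_coeff w (Suc n) = \<lfloor>1 / cf_rem w n\<rfloor>"

text \<open>Index shifted by two: \<open>cf_denom_shift w n\<close> is \<open>q\<close> at index \<open>n - 2\<close>.\<close>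

fun cf_denom_shift :: "real \<Rightarrow> nat \<Rightarrow> int" where
  "cf_denom_shift w 0 = 1"
| "cf_denom_shift w (Suc 0) = 0"
| "cf_denom_shift w (Suc (Suc n)) =
     cf_coeff w n * cf_denom_shift w (Suc n) + cf_denom_shift w n"

definition cf_denom :: "real \<Rightarrow> nat \<Rightarrow> int" where
  "cf_denom w k = cf_denom_shift w (k + 2)"

lemma rotation_power_neq:
  fixes \<omega> :: real
  assumes "\<omega> \<notin> \<rat>" and "n \<ge> 2"
  shows "exp (2 * of_real pi * \<i> * of_real \<omega>) ^ n \<noteq> exp (2 * of_real pi * \<i> * of_real \<omega>)"
proof
  define l where "l = exp (2 * of_real pi * \<i> * of_real \<omega> :: complex)"
  assume "exp (2 * of_real pi * \<i> * of_real \<omega>) ^ n = exp (2 * of_real pi * \<i> * of_real \<omega>)"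
  then have eq: "l ^ n = l" by (simp add: l_def)
  have "l \<noteq> 0" by (simp add: l_def)
  moreover have "l ^ n = l * l ^ (n - 1)" using assms(2) by (simp flip: power_Suc)
  ultimately have "l ^ (n - 1) = 1" using eq by simp
  then have "exp (of_nat (n - 1) * (2 * of_real pi * \<i> * of_real \<omega> :: complex)) = 1"
    unfolding l_def by (subst exp_of_nat_mult)
  then obtain k :: int where k: "real (n - 1) * (2 * pi * \<omega>) = of_int (2 * k) * pi"
    by (subst (asm) exp_eq_1) auto
  then have "real (n - 1) * \<omega> = of_int k" by (simp add: algebra_simps)
  moreover have "real (n - 1) \<noteq> 0" using assms(2) by simp
  ultimately have "\<omega> = of_int k / real (n - 1)" by (simp add: field_simps)
  then have "\<omega> \<in> \<rat>" by simp
  with assms(1) show False by simp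
qed

lemma fps_power_nth_cong_le:
  fixes A B :: "complex fps"
  assumes "\<And>k. k \<le> n \<Longrightarrow> fps_nth A k = fps_nth B k"
  shows "fps_nth (A ^ i) n = fps_nth (B ^ i) n"
  using assms
proof (induction i arbitrary: n)
  case (Suc i)
  then show ?case by (auto simp: fps_mult_nth intro!: sum.cong)
qed simp

lemma fps_power_nth_cong_less:
  fixes A B :: "complex fps"
  assumes agree: "\<And>k. k < n \<Longrightarrow> fps_nth A k = fps_nth B k"
    and A0: "fps_nth A 0 = 0" and B0: "fps_nth B 0 = 0" and "i \<ge> 2"
  shows "fps_nth (A ^ i) n = fps_nth (B ^ i) n"
proof -
  obtain j where i: "i = Suc j" and j: "j \<ge> 1" using \<open>i \<ge> 2\<close> by (cases i) auto
  have "fps_nth A k * fps_nth (A ^ j) (n - k) = fps_nth B k * fps_nth (B ^ j) (n - k)"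
    if "k \<le> n" for k
  proof -
    consider "k = 0" | "k = n" | "0 < k" "k < n" using \<open>k \<le> n\<close> by fastforce
    then show ?thesis
    proof cases
      case 1 then show ?thesis using A0 B0 by simp
    next
      case 2 then show ?thesis using A0 B0 j by (simp add: fps_power_zeroth)
    next
      case 3
      then have "fps_nth (A ^ j) (n - k) = fps_nth (B ^ j) (n - k)"
        by (intro fps_power_nth_cong_le agree) auto
      then show ?thesis using 3 agree by simp
    qed
  qed
  then show ?thesis unfolding i by (simp add: fps_mult_nth)
qed

lemma is_linearization_iff:
  fixes F H :: "complex fps"
  assumes F0: "fps_nth F 0 = 0" and F1: "fps_nth F 1 = l"
    and nz: "\<And>n. n \<ge> 2 \<Longrightarrow> l ^ n \<noteq> l"
  shows "is_linearization F H \<longleftrightarrow> fps_nth H 0 = 0 \<and> fps_nth H 1 = 1 \<and>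
    (\<forall>n\<ge>2. fps_nth H n = (\<Sum>i=2..n. fps_nth F i * fps_nth (H ^ i) n) / (l ^ n - l))"
proof -
  have "(fps_compose F H = fps_compose H (fps_const l * fps_X)) \<longleftrightarrow>
    (\<forall>n\<ge>2. fps_nth H n = (\<Sum>i=2..n. fps_nth F i * fps_nth (H ^ i) n) / (l ^ n - l))"
    if H0: "fps_nth H 0 = 0" and H1: "fps_nth H 1 = 1"
  proof -
    have R: "fps_nth (fps_compose H (fps_const l * fps_X)) n = l ^ n * fps_nth H n" for n
      by simp
    have "fps_nth (fps_compose F H) n = fps_nth (fps_compose H (fps_const l * fps_X)) n \<longleftrightarrow>
      (n \<ge> 2 \<longrightarrow> fps_nth H n = (\<Sum>i=2..n. fps_nth F i * fps_nth (H ^ i) n) / (l ^ n - l))" for n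
    proof -
      consider "n = 0" | "n = 1" | "n \<ge> 2" by (cases "n = 0"; cases "n = 1") auto
      then show ?thesis
      proof cases
        case 1 then show ?thesis using F0 H0 by (simp add: R)
      next
        case 2 then show ?thesis using F0 F1 H1 by (simp add: R fps_compose_nth)
      next
        case 3
        have "fps_nth (fps_compose F H) n = (\<Sum>i=0..n. fps_nth F i * fps_nth (H ^ i) n)"
          by (simp add: fps_compose_nth)
        also have "\<dots> = l * fps_nth H n + (\<Sum>i=2..n. fps_nth F i * fps_nth (H ^ i) n)"
          using 3 F0 F1 by (simp add: sum.atLeast_Suc_atMost numeral_2_eq_2)
        finally show ?thesis
          using 3 nz[OF 3] unfolding R by (auto simp: field_simps)
      qed
    qed
    then show ?thesis by (simp add: fps_eq_iff)
  qed
  then show ?thesis using F1 by (auto simp: is_linearization_def)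
qed

lemma linearization_ex1:
  fixes \<omega> :: real and F :: "complex fps"
  assumes om: "\<omega> \<notin> \<rat>" and F0: "fps_nth F 0 = 0"
    and F1: "fps_nth (fps_deriv F) 0 = exp (2 * of_real pi * \<i> * of_real \<omega>)"
  shows "\<exists>!H. is_linearization F H"
proof -
  define l where "l = exp (2 * of_real pi * \<i> * of_real \<omega> :: complex)"
  have F1': "fps_nth F 1 = l" using F1 by (simp add: l_def)
  have nz: "\<And>n. n \<ge> 2 \<Longrightarrow> l ^ n \<noteq> l" unfolding l_def by (rule rotation_power_neq[OF om])
  have iff: "is_linearization F H \<longleftrightarrow> fps_nth H 0 = 0 \<and> fps_nth H 1 = 1 \<and>
    (\<forall>n\<ge>2. fps_nth H n = (\<Sum>i=2..n. fps_nth F i * fps_nth (H ^ i) n) / (l ^ n - l))" for H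
    by (rule is_linearization_iff[OF F0 F1']) (rule nz)
  define trunc where "trunc = (\<lambda>(h :: nat \<Rightarrow> complex) n. Abs_fps (\<lambda>m. if m < n then h m else 0))"
  define P where "P = (\<lambda>h n r. r = (if n = 0 then 0 else if n = 1 then 1 else
      (\<Sum>i=2..n. fps_nth F i * fps_nth (trunc h n ^ i) n) / (l ^ n - l)))"
  have "\<exists>h. \<forall>n. P h n (h n)"
  proof (rule dependent_wellorder_choice)
    fix r :: complex and f g :: "nat \<Rightarrow> complex" and n :: nat
    assume "\<And>y. y < n \<Longrightarrow> f y = g y"
    then have "trunc f n = trunc g n" by (auto simp: trunc_def fps_eq_iff)
    then show "P f n r = P g n r" by (simp add: P_def)
  qed (simp add: P_def)
  then obtain h where h: "\<And>n. P h n (h n)" by blast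
  have h0: "h 0 = 0" and h1: "h 1 = 1" using h[of 0] h[of 1] by (simp_all add: P_def)
  have "is_linearization F (Abs_fps h)"
    unfolding iff
  proof (intro conjI allI impI)
    fix n :: nat assume n: "n \<ge> 2"
    have "fps_nth (trunc h n ^ i) n = fps_nth (Abs_fps h ^ i) n" if "i \<ge> 2" for i
      using that n h0 by (intro fps_power_nth_cong_less) (auto simp: trunc_def)
    then show "fps_nth (Abs_fps h) n =
        (\<Sum>i=2..n. fps_nth F i * fps_nth (Abs_fps h ^ i) n) / (l ^ n - l)"
      using h[of n] n by (simp add: P_def)
  qed (use h0 h1 in simp_all)
  moreover have "H = G" if H: "is_linearization F H" and G: "is_linearization F G" for H G
  proof -
    have "fps_nth H n = fps_nth G n" for n
    proof (induction n rule: less_induct)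
      case (less n)
      consider "n = 0" | "n = 1" | "n \<ge> 2" by (cases "n = 0"; cases "n = 1") auto
      then show ?case
      proof cases
        case 3
        have "fps_nth (H ^ i) n = fps_nth (G ^ i) n" if "i \<ge> 2" for i
          using that less H G unfolding iff by (intro fps_power_nth_cong_less) auto
        then show ?thesis using 3 H G unfolding iff by simp
      qed (use H G iff in simp_all)
    qed
    then show ?thesis by (simp add: fps_eq_iff)
  qed
  ultimately show ?thesis by blast
qed

end

theory Submission
  imports Defs
begin

text \<open>Write \<open>l\<close> for the multiplier. On coefficients \<open>delta_op l\<close> multiplies by \<open>l ^ n - l\<close>, of the same modulus
as \<open>l ^ (n - 1) - 1\<close>, so everything depends on how small and how frequent these numbers are.
Continued fractions answer both questions. The numbers \<open>u\<close> with \<open>norm (l ^ u - 1) < 1 / q k\<close> are at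
least \<open>q k / 2\<close> and at least \<open>q k / 2\<close> apart (\<open>bad_ge\<close>, \<open>bad_gap\<close>), and if \<open>k\<close> is the last scale at which
\<open>u\<close> is bad in this sense, then \<open>norm (l ^ u - 1) \<ge> 1 / q (Suc k)\<close> (\<open>small_divisor_bound\<close>). This
is the right order, as \<open>norm (l ^ u - 1) \<le> 2 \<pi> / q (Suc k)\<close> at \<open>u = q k\<close> (\<open>small_at_denominator\<close>).

For the operator only the size of single divisors matters. The class is stable under coefficientwise
multiplication by factors of growth \<open>exp (o (n ln n))\<close>, and by the above the inverse divisors have
that growth if \<open>ln (q (k + 1)) = o (q k ln (q k))\<close>. Conversely, if the series with coefficients
\<open>(n!)\<^bsup>s\<^esup>\<close> has a preimage in the class, its growth bounds all inverse divisors at once.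

For the linearization, divisors accumulate along trees of convolutions. The frequency estimate bounds
the accumulation by Davie's method: for each scale there is a superadditive function (\<open>davie\<close>)
that jumps by \<open>1\<close> at every bad index and is at most \<open>4 u / q k\<close>. The sum \<open>K\<close> of these functions with
weights \<open>ln (q (Suc k))\<close> is superadditive, its increments dominate the logarithms of the inverse
divisors (\<open>K_jump\<close>), and \<open>K u\<close> is at most \<open>4 u\<close> times a partial Brjuno sum over scales with
\<open>q k \<le> 2 u\<close> (\<open>K_le_brjuno_sum\<close>), thus \<open>o (u ln u)\<close> under the hypothesis. Dividing the coefficients of
the linearization by \<open>(n!)\<^bsup>\<sigma>\<^esup> exp (K (n - 1))\<close> then leaves a majorant series without small divisors and
with geometric coefficients (\<open>siegel_majorant\<close>). Since \<open>\<sigma> > s\<close> is arbitrary and the factor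
\<open>exp (K n)\<close> fits into \<open>(n!)\<^bsup>\<epsilon>\<^esup>\<close> up to a geometric factor, the linearization lies in the class.\<close>

section \<open>Elementary inequalities\<close>

lemma jordan_sine: "2 / pi * x \<le> sin x" if "0 \<le> x" "x \<le> pi / 2"
proof -
  have "convex_on {0..pi} (\<lambda>x. - sin x)"
    by (rule f''_ge0_imp_convex[where f' = "\<lambda>x. - cos x" and f'' = "sin"])
       (auto intro!: derivative_eq_intros sin_ge_zero)
  then have "concave_on {0..pi} sin" by (simp add: concave_on_def)
  from concave_onD[OF this, of "2 / pi * x" 0 "pi / 2"] that
  show ?thesis by (simp add: field_simps)
qed

lemma fact_fact_mult_le:
  fixes i j m :: nat
  assumes "i \<le> j" "m \<ge> 1"
  shows "Suc i * fact m * fact j \<le> (fact (m + j) :: nat)"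
  using assms(2)
proof (induction m rule: dec_induct)
  case base
  show ?case using assms(1) by (simp add: mult_le_mono1)
next
  case (step m)
  have "Suc i * fact (Suc m) * fact j = Suc m * (Suc i * fact m * (fact j :: nat))"
    by (simp only: fact_Suc of_nat_id mult_ac)
  also have "\<dots> \<le> Suc (m + j) * fact (m + j)" using step by (intro mult_le_mono) auto
  finally show ?case by simp
qed

text \<open>Iterated over the entries of a composition \<open>n = n\<^sub>1 + \<dots> + n\<^sub>i\<close> into positive parts, this is
\<open>i! n\<^sub>1! \<dots> n\<^sub>i! \<le> n!\<close>. It is what makes Gevrey bounds stable under substitution of series: the
weight \<open>i!\<close> of the outer coefficient and the weights of the \<open>i\<close> inner ones fit into \<open>n!\<close>.\<close>

lemma fact_ratio_powr_mult_le:
  fixes \<sigma> :: real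
  assumes "\<sigma> \<ge> 0" "m \<ge> 1" "i \<le> n - m" "m \<le> n"
  shows "fact m powr \<sigma> * (fact (n - m) / fact i) powr \<sigma> \<le> (fact n / fact (Suc i) :: real) powr \<sigma>"
proof -
  have "real (Suc i * fact m * fact (n - m)) \<le> real (fact (m + (n - m)))"
    using fact_fact_mult_le[of i "n - m" m] assms by (simp only: of_nat_le_iff)
  then have "real (Suc i) * fact m * fact (n - m) / (real (Suc i) * fact i) \<le> fact n / (real (Suc i) * fact i)"
    using assms(4) by (intro divide_right_mono) (simp_all only: of_nat_mult of_nat_fact le_add_diff_inverse, simp)
  then have "fact m * (fact (n - m) / fact i) \<le> (fact n / fact (Suc i) :: real)"
    by (simp add: mult.assoc del: of_nat_Suc)
  then show ?thesis using assms(1)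
    by (subst powr_mult[symmetric]) (auto intro!: powr_mono2)
qed

lemma n_ln_n_le: "real n * ln n \<le> ln (fact n) + n"
proof (cases "n = 0")
  case False
  have "(\<Sum>k\<in>{n}. real n ^ k /\<^sub>R fact k) \<le> (\<Sum>k. real n ^ k /\<^sub>R fact k)"
    by (rule sum_le_suminf) (auto intro: summable_exp simp: mult.commute)
  then have "real n ^ n / fact n \<le> exp n"
    by (simp add: exp_def divide_inverse mult.commute)
  then have "ln (real n ^ n) \<le> ln (exp n * fact n)"
    using False by (subst ln_le_cancel_iff) (auto simp: field_simps)
  then show ?thesis using False by (simp add: ln_mult ln_realpow)
qed simp

text \<open>A factor \<open>n\<^bsup>\<epsilon>n\<^esup>\<close> costs no more than \<open>(n!)\<^bsup>\<epsilon>\<^esup>\<close> up to a geometric factor, and is therefore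
invisible in the intersection over all Gevrey orders above \<open>s\<close>.\<close>

lemma exp_n_ln_n_le_fact_powr:
  assumes "\<epsilon> \<ge> 0"
  shows "exp (n * (C + \<epsilon> * ln n)) \<le> exp (C + \<epsilon>) ^ n * (fact n :: real) powr \<epsilon>"
proof -
  have "\<epsilon> * (real n * ln n) \<le> \<epsilon> * (ln (fact n) + n)"
    using n_ln_n_le assms by (intro mult_left_mono)
  then have "exp (n * (C + \<epsilon> * ln n)) \<le> exp (n * (C + \<epsilon>) + \<epsilon> * ln (fact n))"
    by (simp add: algebra_simps)
  also have "\<dots> = exp (C + \<epsilon>) ^ n * (fact n :: real) powr \<epsilon>"
    by (simp add: exp_add exp_of_nat_mult powr_def)
  finally show ?thesis .
qed

section \<open>Gevrey classes\<close>

lemma A_class_iff: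
  "f \<in> A_class s \<longleftrightarrow> fps_nth f 0 = 0 \<and> (\<forall>s'>s. \<exists>c1>0. \<exists>c2>0. \<forall>n\<ge>1.
     norm (fps_nth f n) \<le> c1 * c2 ^ n * fact n powr s')"
  using gt_ex[of s] by (auto simp: A_class_def gevrey_def)

lemma gevrey_boundI:
  fixes f :: "complex fps"
  assumes "c1 > 0" "c2 > 0" "\<And>n. n \<ge> 1 \<Longrightarrow> norm (fps_nth f n) \<le> c1 * c2 ^ n * fact n powr s"
  shows "\<exists>c1>0. \<exists>c2>0. \<forall>n\<ge>1. norm (fps_nth f n) \<le> c1 * c2 ^ n * fact n powr s"
  using assms by blast

text \<open>Coefficientwise multiplication by numbers of size \<open>exp (o (n ln n))\<close> preserves the class: write
\<open>s' = s + \<epsilon> + \<epsilon>\<close> and let the multiplier use up one \<open>\<epsilon>\<close>.\<close>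

lemma A_class_mult_subfactorial:
  assumes g: "g \<in> A_class s" and f0: "fps_nth f 0 = 0"
    and le: "\<And>\<epsilon>. \<epsilon> > 0 \<Longrightarrow> \<exists>C. \<forall>n\<ge>1. norm (fps_nth f n) \<le> norm (fps_nth g n) * exp (n * (C + \<epsilon> * ln n))"
  shows "f \<in> A_class s"
  unfolding A_class_iff
proof (intro conjI allI impI)
  fix s' assume "s' > s"
  define \<epsilon> where "\<epsilon> = (s' - s) / 2"
  have \<epsilon>: "\<epsilon> > 0" "s + \<epsilon> > s" "s + \<epsilon> + \<epsilon> = s'" using \<open>s' > s\<close> by (auto simp: \<epsilon>_def field_simps)
  obtain C where C: "\<And>n. n \<ge> 1 \<Longrightarrow> norm (fps_nth f n) \<le> norm (fps_nth g n) * exp (n * (C + \<epsilon> * ln n))"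
    using le[OF \<epsilon>(1)] by blast
  obtain c1 c2 where c: "c1 > 0" "c2 > 0"
    "\<And>n. n \<ge> 1 \<Longrightarrow> norm (fps_nth g n) \<le> c1 * c2 ^ n * fact n powr (s + \<epsilon>)"
    using g \<epsilon>(2) unfolding A_class_iff by blast
  have "norm (fps_nth f n) \<le> c1 * (c2 * exp (C + \<epsilon>)) ^ n * fact n powr s'" if "n \<ge> 1" for n
  proof -
    have "norm (fps_nth f n) \<le> norm (fps_nth g n) * exp (n * (C + \<epsilon> * ln n))" using C that by blast
    also have "\<dots> \<le> (c1 * c2 ^ n * fact n powr (s + \<epsilon>)) * (exp (C + \<epsilon>) ^ n * fact n powr \<epsilon>)"
      using c that \<epsilon> by (intro mult_mono exp_n_ln_n_le_fact_powr) auto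
    also have "\<dots> = c1 * (c2 * exp (C + \<epsilon>)) ^ n * (fact n powr (s + \<epsilon>) * fact n powr \<epsilon>)"
      by (simp add: power_mult_distrib mult_ac)
    also have "fact n powr (s + \<epsilon>) * fact n powr \<epsilon> = (fact n :: real) powr s'"
      unfolding powr_add[symmetric] \<epsilon>(3) ..
    finally show ?thesis .
  qed
  then show "\<exists>c1>0. \<exists>c2>0. \<forall>n\<ge>1. norm (fps_nth f n) \<le> c1 * c2 ^ n * fact n powr s'"
    using c(1,2) by (intro gevrey_boundI[of c1 "c2 * exp (C + \<epsilon>)"]) auto
qed (rule f0)

lemma A_class_mult_bounded:
  assumes g: "g \<in> A_class s" and f0: "fps_nth f 0 = 0"
    and le: "\<And>n. n \<ge> 1 \<Longrightarrow> norm (fps_nth f n) \<le> M * norm (fps_nth g n)"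
  shows "f \<in> A_class s"
proof (rule A_class_mult_subfactorial[OF g f0])
  fix \<epsilon> :: real assume "\<epsilon> > 0"
  have "norm (fps_nth f n) \<le> norm (fps_nth g n) * exp (n * (\<bar>M\<bar> + \<epsilon> * ln n))" if "n \<ge> 1" for n
  proof -
    have "1 * (\<bar>M\<bar> + 0) \<le> n * (\<bar>M\<bar> + \<epsilon> * ln n)"
      using that \<open>\<epsilon> > 0\<close> by (intro mult_mono add_left_mono) auto
    then have "M \<le> exp (n * (\<bar>M\<bar> + \<epsilon> * ln n))"
      using exp_ge_add_one_self[of "n * (\<bar>M\<bar> + \<epsilon> * ln n)"] unfolding mult_1 by linarith
    then show ?thesis using le[OF that] mult_left_mono[of M "exp (n * (\<bar>M\<bar> + \<epsilon> * ln n))" "norm (fps_nth g n)"]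
      by (simp add: mult.commute)
  qed
  then show "\<exists>C. \<forall>n\<ge>1. norm (fps_nth f n) \<le> norm (fps_nth g n) * exp (n * (C + \<epsilon> * ln n))" by blast
qed

lemma A_class_add:
  assumes "f \<in> A_class s" "g \<in> A_class s"
  shows "f + g \<in> A_class s"
  unfolding A_class_iff
proof (intro conjI allI impI)
  show "fps_nth (f + g) 0 = 0" using assms by (simp add: A_class_iff)
  fix s' assume "s' > s"
  then obtain c1 c2 where c: "c1 > 0" "c2 > 0"
    "\<And>n. n \<ge> 1 \<Longrightarrow> norm (fps_nth f n) \<le> c1 * c2 ^ n * fact n powr s'"
    using assms unfolding A_class_iff by blast
  obtain d1 d2 where d: "d1 > 0" "d2 > 0"
    "\<And>n. n \<ge> 1 \<Longrightarrow> norm (fps_nth g n) \<le> d1 * d2 ^ n * fact n powr s'"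
    using assms \<open>s' > s\<close> unfolding A_class_iff by blast
  have "norm (fps_nth (f + g) n) \<le> (c1 + d1) * (c2 + d2) ^ n * fact n powr s'" if "n \<ge> 1" for n
  proof -
    have "norm (fps_nth (f + g) n) \<le> norm (fps_nth f n) + norm (fps_nth g n)"
      by (simp add: norm_triangle_ineq)
    also have "\<dots> \<le> c1 * c2 ^ n * fact n powr s' + d1 * d2 ^ n * fact n powr s'"
      using c d that by (intro add_mono) auto
    also have "\<dots> \<le> c1 * (c2 + d2) ^ n * fact n powr s' + d1 * (c2 + d2) ^ n * fact n powr s'"
      using c d by (intro add_mono mult_right_mono mult_left_mono power_mono) auto
    finally show ?thesis by (simp add: algebra_simps)
  qed
  then show "\<exists>c1>0. \<exists>c2>0. \<forall>n\<ge>1. norm (fps_nth (f + g) n) \<le> c1 * c2 ^ n * fact n powr s'"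
    using c(1,2) d(1,2) by (intro gevrey_boundI[of "c1 + d1" "c2 + d2"]) auto
qed

lemma A_class_0: "0 \<in> A_class s"
  unfolding A_class_iff using gevrey_boundI[of 1 1 0] by auto

lemma A_class_scale: "f \<in> A_class s \<Longrightarrow> fps_const c * f \<in> A_class s"
  by (rule A_class_mult_bounded[where M = "norm c"]) (auto simp: A_class_iff norm_mult)

lemma subspace_zA_class: "fps_vs.subspace (zA_class s)"
proof (rule fps_vs.subspaceI)
  show "0 \<in> zA_class s" using A_class_0 by (force simp: zA_class_def)
next
  fix f g assume "f \<in> zA_class s" "g \<in> zA_class s"
  then show "f + g \<in> zA_class s" by (auto simp: zA_class_def A_class_add simp flip: distrib_left)
next
  fix c f assume "f \<in> zA_class s"
  then show "fps_const c * f \<in> zA_class s"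
    by (auto simp: zA_class_def A_class_scale mult.left_commute[of _ fps_X])
qed

lemma delta_op_fps_X_mult:
  assumes "fps_nth g 0 = 0"
  shows "delta_op l (fps_X * g) = fps_X * Abs_fps (\<lambda>n. (l ^ Suc n - l) * fps_nth g n)"
  using assms by (auto simp: fps_eq_iff delta_op_def numeral_2_eq_2 not_less_eq_eq le_Suc_eq gr0_conv_Suc)

lemma acts_linearly_on_delta_op:
  assumes "norm l \<le> 1"
  shows "acts_linearly_on (delta_op l) (zA_class s)"
  unfolding acts_linearly_on_def
proof (intro conjI ballI allI)
  fix f assume "f \<in> zA_class s"
  then obtain g where g: "g \<in> A_class s" "f = fps_X * g" by (auto simp: zA_class_def)
  have "Abs_fps (\<lambda>n. (l ^ Suc n - l) * fps_nth g n) \<in> A_class s"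
  proof (rule A_class_mult_bounded[OF g(1), where M = 2])
    fix n
    have "norm (l ^ Suc n - l) \<le> norm (l ^ Suc n) + norm l" by (rule norm_triangle_ineq4)
    also have "\<dots> \<le> 1 + 1" using assms unfolding norm_power by (intro add_mono power_le_one) auto
    finally show "norm (fps_nth (Abs_fps (\<lambda>n. (l ^ Suc n - l) * fps_nth g n)) n) \<le> 2 * norm (fps_nth g n)"
      by (simp add: norm_mult mult_right_mono del: power_Suc)
  qed (use g in \<open>simp add: A_class_iff\<close>)
  then show "delta_op l f \<in> zA_class s"
    using g by (simp add: delta_op_fps_X_mult A_class_iff[of g] zA_class_def)
qed (auto simp: subspace_zA_class delta_op_def fps_eq_iff algebra_simps)

section \<open>A majorant for the linearization equation\<close>

lemma fps_power_nth_nonneg: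
  fixes G :: "real fps"
  assumes "\<And>n. fps_nth G n \<ge> 0"
  shows "fps_nth (G ^ i) n \<ge> 0"
  using assms by (induction i arbitrary: n) (auto simp: fps_mult_nth intro!: sum_nonneg)

text \<open>Expand the product on the right: since \<open>G\<close> has no constant term, a monomial of degree at most
\<open>N + j\<close> in \<open>G ^ Suc j\<close> involves only coefficients of \<open>G\<close> up to \<open>N\<close>. The shift by \<open>j\<close> lets the
partial sums in the next lemma be bounded recursively.\<close>

lemma fps_power_partial_sum_le:
  fixes G :: "real fps"
  assumes G0: "fps_nth G 0 = 0" and nonneg: "\<And>n. fps_nth G n \<ge> 0" and "r \<ge> 0"
  shows "(\<Sum>n\<le>N + j. fps_nth (G ^ Suc j) n * r ^ n) \<le> (\<Sum>n\<le>N. fps_nth G n * r ^ n) ^ Suc j"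
proof (induction j)
  case (Suc j)
  define g where "g m k = (fps_nth G m * r ^ m) * (fps_nth (G ^ Suc j) k * r ^ k)" for m k
  have g_nonneg: "g m k \<ge> 0" for m k
    unfolding g_def using nonneg \<open>r \<ge> 0\<close>
    by (intro mult_nonneg_nonneg fps_power_nth_nonneg) auto
  have g_zero: "g m k = 0" if "m > N \<or> k > N + j" "m + k \<le> N + Suc j" for m k
  proof -
    have "m = 0 \<or> k < Suc j" using that by auto
    then show ?thesis using startsby_zero_power_prefix[OF G0, of "Suc j"] by (auto simp: g_def G0)
  qed
  let ?T = "{(m, k). m + k \<le> N + Suc j}" and ?B = "{..N} \<times> {..N + j}"
  have T: "finite ?T"
    by (rule finite_subset[of _ "{..N + Suc j} \<times> {..N + Suc j}"]) auto
  have "(\<Sum>n\<le>N + Suc j. fps_nth (G ^ Suc (Suc j)) n * r ^ n) = (\<Sum>n\<le>N + Suc j. \<Sum>m\<le>n. g m (n - m))"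
  proof (intro sum.cong refl)
    fix n
    have "r ^ n = r ^ m * r ^ (n - m)" if "m \<le> n" for m using that by (simp flip: power_add)
    then show "fps_nth (G ^ Suc (Suc j)) n * r ^ n = (\<Sum>m\<le>n. g m (n - m))"
      by (subst power_Suc, subst fps_mult_nth, unfold sum_distrib_right atMost_atLeast0)
         (auto simp: g_def mult_ac intro!: sum.cong simp del: power_Suc)
  qed
  also have "\<dots> = (\<Sum>(m, k)\<in>?T. g m k)" by (rule sum.triangle_reindex_eq[symmetric])
  also have "\<dots> = (\<Sum>(m, k)\<in>?T \<inter> ?B. g m k)"
    using T g_zero by (intro sum.mono_neutral_right) (auto simp: not_le[symmetric])
  also have "\<dots> \<le> (\<Sum>(m, k)\<in>?B. g m k)"
    using g_nonneg by (intro sum_mono2) auto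
  also have "\<dots> = (\<Sum>m\<le>N. fps_nth G m * r ^ m) * (\<Sum>k\<le>N + j. fps_nth (G ^ Suc j) k * r ^ k)"
    unfolding g_def by (simp only: sum_product sum.cartesian_product)
  also have "\<dots> \<le> (\<Sum>m\<le>N. fps_nth G m * r ^ m) * (\<Sum>m\<le>N. fps_nth G m * r ^ m) ^ Suc j"
    using Suc nonneg \<open>r \<ge> 0\<close> by (intro mult_left_mono sum_nonneg) auto
  finally show ?case by simp
qed simp

lemma sum_power_from_2_le:
  fixes x :: real
  assumes "0 \<le> x" "x \<le> 1 / 2"
  shows "(\<Sum>i=2..n. x ^ i) \<le> 2 * x ^ 2"
proof (cases "n \<ge> 2")
  case True
  have "(\<Sum>i=2..n. x ^ i) + x ^ n \<le> 2 * x ^ 2"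
    using True
  proof (induction n rule: dec_induct)
    case (step n)
    have "x ^ n * (2 * x) \<le> x ^ n * 1" using assms by (intro mult_left_mono) auto
    then show ?case using step by (simp add: mult_ac)
  qed simp
  then show ?thesis using assms(1) zero_le_power[of x n] by linarith
qed simp

text \<open>This replaces the analytic implicit function theorem for \<open>\<sigma> = z + c1 (c2 \<sigma>)\<^sup>2 / (1 - c2 \<sigma>)\<close>.
With \<open>S\<^sub>N\<close> the \<open>N\<close>-th partial sum of \<open>G\<close> at a small radius \<open>r\<close>, the recursion yields
\<open>S\<^sub>N\<^sub>+\<^sub>1 \<le> r + 2 c1 (c2 S\<^sub>N)\<^sup>2\<close> as long as \<open>c2 S\<^sub>N \<le> 1/2\<close>, so \<open>S\<^sub>N \<le> 2r\<close> propagates.\<close>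

lemma fps_geometric_majorant:
  fixes G :: "real fps"
  assumes G0: "fps_nth G 0 = 0" and G1: "fps_nth G 1 \<le> 1" and nonneg: "\<And>n. fps_nth G n \<ge> 0"
    and c: "c1 > 0" "c2 > 0"
    and rec: "\<And>n. n \<ge> 2 \<Longrightarrow> fps_nth G n \<le> (\<Sum>i=2..n. c1 * c2 ^ i * fps_nth (G ^ i) n)"
  shows "\<exists>R>0. \<forall>n. fps_nth G n \<le> R ^ n"
proof -
  \<comment> \<open>Each summand of \<open>D\<close> secures one of the three smallness conditions on the radius \<open>r\<close>.\<close>
  define D where "D = 2 + 4 * c2 + 8 * c1 * c2 ^ 2"
  define r where "r = 1 / D"
  have D: "D \<ge> 2" "D > 0" using c by (auto simp: D_def intro!: add_pos_pos)
  have r: "r > 0" "r \<le> 1 / 2" "2 * c2 * r \<le> 1 / 2" "8 * c1 * c2 ^ 2 * r \<le> 1"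
    using c D by (auto simp: r_def field_simps) (auto simp: D_def)
  define S where "S N = (\<Sum>n\<le>N. fps_nth G n * r ^ n)" for N
  have S_nonneg: "S N \<ge> 0" for N unfolding S_def using nonneg r by (intro sum_nonneg) auto
  have S_le: "S N \<le> 2 * r" for N
  proof (induction N)
    case 0 show ?case using r G0 by (simp add: S_def)
  next
    case (Suc N)
    have "{..Suc N} = {0, 1} \<union> {2..Suc N}" by auto
    then have "S (Suc N) = fps_nth G 1 * r + (\<Sum>n=2..Suc N. fps_nth G n * r ^ n)"
      unfolding S_def by (simp only:) (subst sum.union_disjoint, auto simp: G0)
    also have "fps_nth G 1 * r \<le> 1 * r" using G1 r by (intro mult_right_mono) auto
    also have "(\<Sum>n=2..Suc N. fps_nth G n * r ^ n) \<le>
        (\<Sum>n=2..Suc N. (\<Sum>i=2..n. c1 * c2 ^ i * fps_nth (G ^ i) n) * r ^ n)"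
      using rec r by (intro sum_mono mult_right_mono) auto
    also have "\<dots> \<le> (\<Sum>n=2..Suc N. \<Sum>i=2..Suc N. c1 * c2 ^ i * fps_nth (G ^ i) n * r ^ n)"
      unfolding sum_distrib_right using c r fps_power_nth_nonneg[OF nonneg]
      by (intro sum_mono sum_mono2) auto
    also have "\<dots> = (\<Sum>i=2..Suc N. c1 * c2 ^ i * (\<Sum>n=2..Suc N. fps_nth (G ^ i) n * r ^ n))"
      by (subst sum.swap) (simp add: sum_distrib_left mult.assoc del: sum.cl_ivl_Suc)
    also have "\<dots> \<le> (\<Sum>i=2..Suc N. c1 * c2 ^ i * S N ^ i)"
    proof (intro sum_mono mult_left_mono)
      fix i assume i: "i \<in> {2..Suc N}"
      then obtain j where j: "i = Suc (Suc j)" by (auto dest!: le_Suc_ex)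
      have "(\<Sum>n=2..Suc N. fps_nth (G ^ i) n * r ^ n) \<le> (\<Sum>n\<le>N + Suc j. fps_nth (G ^ i) n * r ^ n)"
        using r fps_power_nth_nonneg[OF nonneg] by (intro sum_mono2) auto
      also have "\<dots> \<le> S N ^ i"
        unfolding j S_def using G0 nonneg r by (intro fps_power_partial_sum_le) auto
      finally show "(\<Sum>n=2..Suc N. fps_nth (G ^ i) n * r ^ n) \<le> S N ^ i" .
    qed (use c in auto)
    also have "\<dots> = c1 * (\<Sum>i=2..Suc N. (c2 * S N) ^ i)"
      by (simp add: sum_distrib_left power_mult_distrib mult.assoc del: sum.cl_ivl_Suc)
    also have "\<dots> \<le> c1 * (2 * (c2 * S N) ^ 2)"
    proof (intro mult_left_mono sum_power_from_2_le)
      have "c2 * S N \<le> c2 * (2 * r)" using Suc c by (intro mult_left_mono) auto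
      then show "c2 * S N \<le> 1 / 2" using r by linarith
    qed (use c S_nonneg in auto)
    also have "\<dots> \<le> c1 * (2 * (c2 * (2 * r)) ^ 2)"
      using Suc c S_nonneg by (intro mult_left_mono power_mono) auto
    also have "\<dots> = (8 * c1 * c2 ^ 2 * r) * r" by (simp add: power2_eq_square)
    also have "\<dots> \<le> 1 * r" using r by (intro mult_right_mono) auto
    finally show ?case by simp
  qed
  have "fps_nth G n \<le> D ^ n" for n
  proof -
    have "fps_nth G n * r ^ n \<le> S n" unfolding S_def
      using nonneg r by (intro member_le_sum) auto
    also have "\<dots> \<le> 1" using S_le[of n] r by simp
    finally show ?thesis using D by (simp add: r_def power_divide field_simps)
  qed
  then show ?thesis using D by blast
qed

text \<open>The recursion for \<open>H\<close> is the linearization equation with the small divisor at index \<open>n\<close> bounded by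
an increment of \<open>K\<close>. Dividing the coefficients of \<open>H\<close> by \<open>(n!)\<^bsup>\<sigma>\<^esup> exp (K (n - 1))\<close> removes both
the Gevrey growth of \<open>f\<close> and the small divisors. The reason: a product of \<open>i\<close> coefficients with
total index \<open>n\<close> collects at most \<open>exp (K (n - i))\<close> by superadditivity, because \<open>\<Sum> (n\<^sub>j - 1) = n - i\<close>;
as \<open>i \<ge> 2\<close> this is at most \<open>exp (K (n - 2))\<close>, which leaves exactly the increment
\<open>K (n - 1) - K (n - 2)\<close> for the new divisor.\<close>

lemma siegel_majorant:
  fixes H :: "complex fps" and f :: "nat \<Rightarrow> complex" and K :: "nat \<Rightarrow> real"
  assumes H0: "fps_nth H 0 = 0" and H1: "norm (fps_nth H 1) \<le> 1" and "\<sigma> \<ge> 0"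
    and K_nonneg: "\<And>u. K u \<ge> 0" and K_superadd: "\<And>u v. K u + K v \<le> K (u + v)"
    and c: "c1 > 0" "c2 > 0"
    and f: "\<And>i. i \<ge> 1 \<Longrightarrow> norm (f i) \<le> c1 * c2 ^ i * fact i powr \<sigma>"
    and rec: "\<And>n. n \<ge> 2 \<Longrightarrow> norm (fps_nth H n) \<le>
      exp (K (n - 1) - K (n - 2)) * (\<Sum>i=2..n. norm (f i) * norm (fps_nth (H ^ i) n))"
  shows "\<exists>R>0. \<forall>n. norm (fps_nth H n) \<le> R ^ n * fact n powr \<sigma> * exp (K (n - 1))"
proof -
  define W where "W n = fact n powr \<sigma> * exp (K (n - 1))" for n
  have W: "W n > 0" for n by (simp add: W_def)
  define G where "G = Abs_fps (\<lambda>n. norm (fps_nth H n) / W n)"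
  have G_nonneg: "fps_nth G n \<ge> 0" for n using W[of n] by (simp add: G_def)
  have K_mono: "K u \<le> K v" if "u \<le> v" for u v
    using K_superadd[of u "v - u"] K_nonneg[of "v - u"] that by simp
  have H_eq: "norm (fps_nth H n) = W n * fps_nth G n" for n using W[of n] by (simp add: G_def)
  have power_bound: "norm (fps_nth (H ^ Suc j) n) \<le>
      (fact n / fact (Suc j)) powr \<sigma> * exp (K (n - Suc j)) * fps_nth (G ^ Suc j) n" for j n
  proof (induction j arbitrary: n)
    case 0
    show ?case using H_eq[of n] by (simp add: W_def)
  next
    case (Suc j)
    let ?R = "(fact n / fact (Suc (Suc j))) powr \<sigma> * exp (K (n - Suc (Suc j)))"
    have "norm (fps_nth (H ^ Suc (Suc j)) n) \<le>
        (\<Sum>m=0..n. norm (fps_nth H m) * norm (fps_nth (H ^ Suc j) (n - m)))"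
      by (subst power_Suc, subst fps_mult_nth, rule order.trans[OF norm_sum]) (simp add: norm_mult del: power_Suc)
    also have "\<dots> \<le> (\<Sum>m=0..n. ?R * (fps_nth G m * fps_nth (G ^ Suc j) (n - m)))"
    proof (rule sum_mono)
      fix m assume m: "m \<in> {0..n}"
      show "norm (fps_nth H m) * norm (fps_nth (H ^ Suc j) (n - m)) \<le>
          ?R * (fps_nth G m * fps_nth (G ^ Suc j) (n - m))"
      proof (cases "m = 0 \<or> n - m < Suc j")
        case True
        then have "norm (fps_nth H m) * norm (fps_nth (H ^ Suc j) (n - m)) = 0"
          using H0 startsby_zero_power_prefix[OF H0, of "Suc j"] by auto
        moreover have "?R * (fps_nth G m * fps_nth (G ^ Suc j) (n - m)) \<ge> 0"
          by (intro mult_nonneg_nonneg G_nonneg fps_power_nth_nonneg) auto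
        ultimately show ?thesis by linarith
      next
        case False
        then have m': "m \<ge> 1" "Suc j \<le> n - m" "m \<le> n" using m by auto
        have "norm (fps_nth H m) * norm (fps_nth (H ^ Suc j) (n - m)) \<le>
            (W m * fps_nth G m) * ((fact (n - m) / fact (Suc j)) powr \<sigma> * exp (K (n - m - Suc j)) *
              fps_nth (G ^ Suc j) (n - m))"
          unfolding H_eq using W[of m] G_nonneg by (intro mult_left_mono Suc.IH) (auto simp: less_imp_le)
        also have "\<dots> = (fact m powr \<sigma> * (fact (n - m) / fact (Suc j)) powr \<sigma>) *
            exp (K (m - 1) + K (n - m - Suc j)) * (fps_nth G m * fps_nth (G ^ Suc j) (n - m))"
          by (simp add: W_def exp_add mult_ac del: power_Suc)
        also have "\<dots> \<le> ?R * (fps_nth G m * fps_nth (G ^ Suc j) (n - m))"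
        proof (intro mult_right_mono mult_mono)
          have "m - 1 + (n - m - Suc j) = n - Suc (Suc j)" using m' by simp
          then show "exp (K (m - 1) + K (n - m - Suc j)) \<le> exp (K (n - Suc (Suc j)))"
            using K_superadd[of "m - 1" "n - m - Suc j"] by simp
          show "fact m powr \<sigma> * (fact (n - m) / fact (Suc j)) powr \<sigma> \<le> (fact n / fact (Suc (Suc j)) :: real) powr \<sigma>"
            using m' \<open>\<sigma> \<ge> 0\<close> by (intro fact_ratio_powr_mult_le)
        qed (auto intro!: mult_nonneg_nonneg G_nonneg fps_power_nth_nonneg simp del: power_Suc)
        finally show ?thesis .
      qed
    qed
    also have "\<dots> = ?R * fps_nth (G ^ Suc (Suc j)) n"
      by (subst (2) power_Suc, subst fps_mult_nth) (simp add: sum_distrib_left del: power_Suc)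
    finally show ?case .
  qed
  have "fps_nth G n \<le> (\<Sum>i=2..n. c1 * c2 ^ i * fps_nth (G ^ i) n)" if n: "n \<ge> 2" for n
  proof -
    have "(\<Sum>i=2..n. norm (f i) * norm (fps_nth (H ^ i) n)) \<le>
        (\<Sum>i=2..n. (fact n powr \<sigma> * exp (K (n - 2))) * (c1 * c2 ^ i * fps_nth (G ^ i) n))"
    proof (rule sum_mono)
      fix i assume i: "i \<in> {2..n}"
      then obtain j where j: "i = Suc j" by (cases i) auto
      have "norm (f i) * norm (fps_nth (H ^ i) n) \<le> (c1 * c2 ^ i * fact i powr \<sigma>) *
          ((fact n / fact i) powr \<sigma> * exp (K (n - i)) * fps_nth (G ^ i) n)"
        using i c power_bound[of j n] by (intro mult_mono f) (auto simp: j)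
      also have "\<dots> = exp (K (n - i)) * (fact n powr \<sigma> * (c1 * c2 ^ i * fps_nth (G ^ i) n))"
        by (simp add: powr_divide)
      also have "\<dots> \<le> exp (K (n - 2)) * (fact n powr \<sigma> * (c1 * c2 ^ i * fps_nth (G ^ i) n))"
        using i c K_mono[of "n - i" "n - 2"]
        by (intro mult_right_mono mult_nonneg_nonneg fps_power_nth_nonneg G_nonneg) auto
      finally show "norm (f i) * norm (fps_nth (H ^ i) n) \<le>
          (fact n powr \<sigma> * exp (K (n - 2))) * (c1 * c2 ^ i * fps_nth (G ^ i) n)"
        by (simp add: mult_ac)
    qed
    also have "\<dots> = fact n powr \<sigma> * exp (K (n - 2)) * (\<Sum>i=2..n. c1 * c2 ^ i * fps_nth (G ^ i) n)"
      by (rule sum_distrib_left[symmetric])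
    finally have "norm (fps_nth H n) \<le> exp (K (n - 1) - K (n - 2)) *
        (fact n powr \<sigma> * exp (K (n - 2)) * (\<Sum>i=2..n. c1 * c2 ^ i * fps_nth (G ^ i) n))"
      using rec[OF n] by (meson exp_ge_zero mult_left_mono order.trans)
    also have "\<dots> = W n * (\<Sum>i=2..n. c1 * c2 ^ i * fps_nth (G ^ i) n)"
      by (simp add: W_def exp_diff)
    finally show ?thesis using W[of n] by (simp add: H_eq)
  qed
  moreover have "fps_nth G 0 = 0" by (simp add: G_def H0)
  moreover have "fps_nth G 1 \<le> 1"
    using H1 K_nonneg[of 0] by (simp add: G_def W_def) (smt (verit) exp_ge_add_one_self divide_le_eq_1)
  ultimately obtain R where "R > 0" "\<And>n. fps_nth G n \<le> R ^ n"
    using fps_geometric_majorant[of G c1 c2] G_nonneg c by blast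
  then have "norm (fps_nth H n) \<le> R ^ n * fact n powr \<sigma> * exp (K (n - 1))" for n
    unfolding H_eq using mult_left_mono[of "fps_nth G n" "R ^ n" "W n"] W[of n] by (simp add: W_def mult_ac)
  then show ?thesis using \<open>R > 0\<close> by blast
qed

section \<open>A superadditive counting function\<close>

definition last_upto :: "nat set \<Rightarrow> nat \<Rightarrow> nat" where
  "last_upto A u = Max (insert 0 {j \<in> A. j \<le> u})"

text \<open>Let \<open>A\<close> be a set of positive integers, \<open>Q\<close>-separated from each other and from \<open>0\<close>. The function counts
generously how many elements of \<open>A\<close> can occur as indices in a tree of convolutions of total weight
\<open>u\<close>. It is a simplified form of Davie's function: it has to be superadditive, to gain \<open>1\<close> at each
element of \<open>A\<close>, and to grow like \<open>u / Q\<close>. The first entry of the maximum is what superadditivity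
demands; the second records that right after an element of \<open>A\<close> one extra unit has been spent, which
the separation gives back before the next element.\<close>

definition davie :: "real \<Rightarrow> nat set \<Rightarrow> nat \<Rightarrow> real" where
  "davie Q A u = (if u < Q then 0 else max (2 * u / Q - 2) (2 * last_upto A u / Q - 1))"

lemma last_upto_le: "last_upto A u \<le> u"
  and last_upto_cases: "last_upto A u = 0 \<or> last_upto A u \<in> A"
  and last_upto_ge: "j \<in> A \<Longrightarrow> j \<le> u \<Longrightarrow> j \<le> last_upto A u"
proof -
  have "finite (insert 0 {j \<in> A. j \<le> u})" by auto
  note Max_in[OF this] Max_ge[OF this]
  then show "last_upto A u \<le> u" "last_upto A u = 0 \<or> last_upto A u \<in> A"
    "j \<in> A \<Longrightarrow> j \<le> u \<Longrightarrow> j \<le> last_upto A u"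
    unfolding last_upto_def by fastforce+
qed

lemma davie_nonneg:
  assumes "Q > 0"
  shows "davie Q A u \<ge> 0"
proof (cases "u < Q")
  case False
  then have "2 * u / Q - 2 \<ge> 0" using assms by (simp add: field_simps)
  then show ?thesis unfolding davie_def by (simp add: le_max_iff_disj)
qed (simp add: davie_def)

lemma davie_le_minus_1:
  assumes "Q > 0" "\<not> u < Q"
  shows "davie Q A u \<le> 2 * u / Q - 1"
proof -
  have "2 * real (last_upto A u) / Q \<le> 2 * u / Q"
    using last_upto_le[of A u] assms by (intro divide_right_mono) auto
  then show ?thesis using assms by (simp add: davie_def)
qed

lemma davie_le:
  assumes "Q > 0"
  shows "davie Q A u \<le> 2 * u / Q"
  using davie_le_minus_1[OF assms, of u A] assms by (cases "u < Q") (auto simp: davie_def)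

lemma davie_mono:
  assumes "Q > 0" "u \<le> v"
  shows "davie Q A u \<le> davie Q A v"
proof (cases "u < Q")
  case True then show ?thesis using davie_nonneg[OF assms(1), of A v] by (simp add: davie_def)
next
  case False
  have "last_upto A u \<le> last_upto A v"
    using last_upto_cases[of A u] last_upto_le[of A u] last_upto_ge[of "last_upto A u" A v] assms by auto
  then have "2 * real (last_upto A u) / Q \<le> 2 * last_upto A v / Q" "2 * u / Q \<le> 2 * v / Q"
    using assms by (auto intro!: divide_right_mono)
  then show ?thesis using False assms(2) unfolding davie_def by auto
qed

text \<open>Below \<open>Q\<close> the function vanishes and the claim is monotonicity. Otherwise each term is at most
\<open>2 u / Q - 1\<close>, and the two units lost together are those of the lower bound \<open>2 (u + v) / Q - 2\<close>.\<close>

lemma davie_superadditive: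
  assumes "Q > 0"
  shows "davie Q A u + davie Q A v \<le> davie Q A (u + v)"
proof (cases "u < Q \<or> v < Q")
  case True
  then show ?thesis using davie_mono[OF assms, of u "u + v" A] davie_mono[OF assms, of v "u + v" A]
    by (auto simp: davie_def[of _ _ u] davie_def[of _ _ v])
next
  case False
  then have "davie Q A u + davie Q A v \<le> 2 * u / Q + 2 * v / Q - 2"
    using davie_le_minus_1[OF assms, of u A] davie_le_minus_1[OF assms, of v A] by simp
  also have "\<dots> = 2 * real (u + v) / Q - 2" by (simp add: add_divide_distrib)
  also have "\<dots> \<le> davie Q A (u + v)" using False unfolding davie_def by simp
  finally show ?thesis .
qed

text \<open>At \<open>u \<in> A\<close> the second entry has its largest value \<open>2 u / Q - 1\<close>, whereas just before, the last element
of \<open>A\<close> lies at least \<open>Q\<close> behind, so both entries are at most \<open>2 u / Q - 2\<close>.\<close>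

lemma davie_jump:
  assumes Q: "Q > 0" and "u \<in> A" "u > 0"
    and ge: "\<And>u. u \<in> A \<Longrightarrow> Q \<le> u" and gap: "\<And>u v. u \<in> A \<Longrightarrow> v \<in> A \<Longrightarrow> u < v \<Longrightarrow> Q \<le> real (v - u)"
  shows "davie Q A (u - 1) + 1 \<le> davie Q A u"
proof -
  have "last_upto A u = u" using last_upto_le[of A u] last_upto_ge[of u A u] assms by auto
  then have u: "davie Q A u \<ge> 2 * u / Q - 1" using ge[OF \<open>u \<in> A\<close>] by (simp add: davie_def)
  have uQ: "2 * u / Q \<ge> 2" using ge[OF \<open>u \<in> A\<close>] Q by (simp add: field_simps)
  show ?thesis
  proof (cases "real (u - 1) < Q")
    case True
    then have "davie Q A (u - 1) = 0" unfolding davie_def by simp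
    then show ?thesis using u uQ by linarith
  next
    case False
    define w where "w = last_upto A (u - 1)"
    have "w \<le> u - 1" unfolding w_def by (rule last_upto_le)
    have "Q \<le> real (u - w)"
      using last_upto_cases[of A "u - 1"] gap[of w u] ge[of u] assms \<open>w \<le> u - 1\<close> by (auto simp: w_def)
    then have "w \<le> u - Q" using \<open>w \<le> u - 1\<close> assms(3) by linarith
    then have "2 * w / Q \<le> 2 * (u - Q) / Q" using Q by (intro divide_right_mono) auto
    also have "\<dots> = 2 * u / Q - 2" using Q by (simp add: right_diff_distrib diff_divide_distrib)
    finally have 1: "2 * w / Q \<le> 2 * u / Q - 2" .
    have 2: "2 * real (u - 1) / Q \<le> 2 * u / Q" using Q by (intro divide_right_mono) auto
    have "davie Q A (u - 1) = max (2 * real (u - 1) / Q - 2) (2 * w / Q - 1)"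
      using False unfolding davie_def w_def by simp
    also have "\<dots> \<le> 2 * u / Q - 2" using 1 2 by simp
    finally show ?thesis using u by linarith
  qed
qed

section \<open>Convergents of an irrational number\<close>

locale irrational_rotation =
  fixes \<omega> :: real
  assumes irrational: "\<omega> \<notin> \<rat>"
begin

definition r :: "nat \<Rightarrow> real" where "r = cf_rem \<omega>"
definition a :: "nat \<Rightarrow> int" where "a = cf_coeff \<omega>"
definition qi :: "nat \<Rightarrow> int" where "qi = cf_denom \<omega>"
fun p :: "nat \<Rightarrow> int" where
  "p 0 = a 0"
| "p (Suc 0) = a 1 * a 0 + 1"
| "p (Suc (Suc n)) = a (Suc (Suc n)) * p (Suc n) + p n"
text \<open>Up to sign the errors \<open>q\<^sub>n \<omega> - p\<^sub>n\<close>, since these obey the recursion of the denominators.\<close>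

definition \<beta> :: "nat \<Rightarrow> real" where "\<beta> n = (\<Prod>i\<le>n. r i)"

lemma r_0: "r 0 = \<omega> - a 0" and r_Suc: "r (Suc n) = 1 / r n - a (Suc n)"
  by (simp_all add: r_def a_def)

lemma qi_rec [simp]: "qi 0 = 1" "qi (Suc 0) = a 1" "qi (Suc (Suc n)) = a (Suc (Suc n)) * qi (Suc n) + qi n"
  by (simp_all add: qi_def a_def cf_denom_def numeral_2_eq_2)

lemma r_irrational: "r n \<notin> \<rat>"
proof (induction n)
  case 0
  have "\<omega> = r 0 + of_int (a 0)" by (simp add: r_0)
  then show ?case using irrational by (metis Rats_add Rats_of_int)
next
  case (Suc n)
  have "r n = inverse (r (Suc n) + of_int (a (Suc n)))" by (simp add: r_Suc inverse_eq_divide)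
  then show ?case using Suc by (metis Rats_add Rats_of_int Rats_inverse)
qed

lemma r_pos: "0 < r n" and r_less_1: "r n < 1"
proof -
  have "\<exists>x. r n = x - of_int \<lfloor>x\<rfloor>" by (cases n) (auto simp: r_def)
  moreover have "r n \<noteq> 0" using r_irrational[of n] by auto
  ultimately have "0 < r n \<and> r n < 1" by (auto simp: less_le) linarith+
  then show "0 < r n" "r n < 1" by auto
qed

lemma a_ge_1: "a (Suc n) \<ge> 1"
  using r_pos[of n] r_less_1[of n] by (simp add: a_def r_def le_floor_iff)

lemma qi_ge_1_mono: "qi n \<ge> 1 \<and> qi n \<le> qi (Suc n)"
proof (induction n)
  case 0 then show ?case using a_ge_1[of 0] by simp
next
  case (Suc n)
  have "1 * qi (Suc n) \<le> a (Suc (Suc n)) * qi (Suc n)"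
    using Suc a_ge_1 by (intro mult_right_mono) auto
  then show ?case using Suc unfolding qi_rec by linarith
qed

lemma qi_ge_1: "qi n \<ge> 1" and qi_mono_Suc: "qi n \<le> qi (Suc n)"
  using qi_ge_1_mono by auto

lemma qi_ge_index: "qi n \<ge> int n"
proof -
  have "qi (Suc n) \<ge> int (Suc n)" for n
  proof (induction n)
    case 0 then show ?case using qi_ge_1[of 1] by simp
  next
    case (Suc n)
    have "1 * qi (Suc n) \<le> a (Suc (Suc n)) * qi (Suc n)"
      using qi_ge_1[of "Suc n"] a_ge_1 by (intro mult_right_mono) auto
    then show ?case using Suc qi_ge_1[of n] unfolding qi_rec of_nat_Suc by linarith
  qed
  then show ?thesis by (cases n) auto
qed

lemma \<beta>_pos: "\<beta> n > 0" by (simp add: \<beta>_def r_pos prod_pos)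
lemma \<beta>_Suc: "\<beta> (Suc n) = \<beta> n * r (Suc n)" by (simp add: \<beta>_def)

lemma convergent_error: "qi n * \<omega> - p n = (-1) ^ n * \<beta> n"
proof (induction n rule: p.induct)
  case 1 show ?case by (simp add: \<beta>_def r_0)
next
  case 2
  have "\<omega> * a 1 = (r 0 + a 0) * a 1" by (simp add: r_0)
  then show ?case using r_pos[of 0] by (auto simp: \<beta>_def r_Suc algebra_simps)
next
  case (3 n)
  have "qi (Suc (Suc n)) * \<omega> - p (Suc (Suc n)) =
      a (Suc (Suc n)) * (qi (Suc n) * \<omega> - p (Suc n)) + (qi n * \<omega> - p n)"
    by (simp add: algebra_simps)
  also have "\<dots> = (-1) ^ n * (\<beta> n - a (Suc (Suc n)) * \<beta> (Suc n))"
    unfolding 3 by (simp add: algebra_simps)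
  also have "\<beta> n - a (Suc (Suc n)) * \<beta> (Suc n) = \<beta> (Suc (Suc n))"
    using r_pos[of "Suc n"] by (simp add: \<beta>_Suc r_Suc[of "Suc n"] algebra_simps)
  finally show ?case by simp
qed

lemma q_\<beta>_identity: "qi (Suc n) * \<beta> n + qi n * \<beta> (Suc n) = 1"
proof (induction n)
  case 0 show ?case using r_pos[of 0] by (simp add: \<beta>_def r_Suc field_simps)
next
  case (Suc n)
  have "\<beta> (Suc (Suc n)) = \<beta> n - a (Suc (Suc n)) * \<beta> (Suc n)"
    using r_pos[of "Suc n"] by (simp add: \<beta>_Suc r_Suc[of "Suc n"] algebra_simps)
  then have "\<beta> (Suc (Suc n)) + \<beta> (Suc n) * a (Suc (Suc n)) = \<beta> n" by simp
  then have "qi (Suc n) * (\<beta> (Suc (Suc n)) + \<beta> (Suc n) * a (Suc (Suc n))) = qi (Suc n) * \<beta> n" by simp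
  then show ?case using Suc by (simp add: algebra_simps)
qed

lemma \<beta>_le: "\<beta> n \<le> 1 / qi (Suc n)"
proof -
  have "qi n * \<beta> (Suc n) \<ge> 0" using qi_ge_1[of n] \<beta>_pos[of "Suc n"] by simp
  then have "qi (Suc n) * \<beta> n \<le> 1" using q_\<beta>_identity[of n] by linarith
  then show ?thesis using qi_ge_1[of "Suc n"] by (simp add: field_simps)
qed

lemma convergent_det: "p (Suc n) * qi n - p n * qi (Suc n) = (-1) ^ n"
  by (induction n) (auto simp: algebra_simps)

lemma coprime_convergent: "coprime (p n) (qi n)"
proof (rule coprimeI)
  fix d assume "d dvd p n" "d dvd qi n"
  then have "d dvd p (Suc n) * qi n - p n * qi (Suc n)" by simp
  then have "d dvd (-1) ^ n" unfolding convergent_det .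
  then show "is_unit d" by (simp add: minus_one_power_iff split: if_splits)
qed

text \<open>By coprimality \<open>m / d\<close> differs from the convergent \<open>p\<^sub>k / q\<^sub>k\<close>, hence by at least \<open>1 / (d q\<^sub>k)\<close>, and
the convergent is so close to \<open>\<omega>\<close> that for \<open>d < q\<^sub>k / 2\<close> at least half of this distance remains.\<close>

lemma approximation_lower_bound:
  fixes d :: nat and m :: int
  assumes "d > 0" "2 * int d < qi k"
  shows "\<bar>d * \<omega> - m\<bar> > 1 / (2 * qi k)"
proof -
  define D where "D = d * p k - m * qi k"
  have "D \<noteq> 0"
  proof
    assume "D = 0"
    then have "qi k dvd p k * int d" unfolding D_def by (metis dvd_triv_right eq_iff_diff_eq_0 mult.commute)
    then have "qi k dvd int d" using coprime_convergent[of k]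
      by (simp add: coprime_commute coprime_dvd_mult_right_iff)
    then have "qi k \<le> int d" using assms(1) by (simp add: zdvd_imp_le)
    then show False using assms by simp
  qed
  have q: "real_of_int (qi k) \<ge> 1" using qi_ge_1[of k] by simp
  have "D = qi k * (d * \<omega> - m) - d * (qi k * \<omega> - p k)" by (simp add: D_def algebra_simps)
  then have "\<bar>real_of_int D\<bar> \<le> qi k * \<bar>d * \<omega> - m\<bar> + d * \<beta> k"
    unfolding convergent_error using q \<beta>_pos[of k] 
    by (metis (no_types, lifting) abs_triangle_ineq4 abs_mult abs_of_nat abs_of_pos abs_minus_cancel abs_one power_abs power_one mult_1 less_le_trans zero_less_one)
  moreover have "\<bar>real_of_int D\<bar> \<ge> 1" using \<open>D \<noteq> 0\<close> by linarith
  moreover have "d * \<beta> k < 1 / 2"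
  proof -
    have "\<beta> k \<le> 1 / qi k" using \<beta>_le[of k] qi_mono_Suc[of k] q 
      by (smt (verit) frac_le of_int_le_iff)
    then have "d * \<beta> k \<le> d * (1 / qi k)" by (intro mult_left_mono) auto
    also have "\<dots> < 1/2" using assms q by (simp add: field_simps)
    finally show ?thesis .
  qed
  ultimately have "qi k * \<bar>d * \<omega> - m\<bar> > 1 / 2" by linarith
  then show ?thesis using q by (simp add: field_simps)
qed

section \<open>Small divisors of an irrational rotation\<close>

definition l :: complex where "l = exp (2 * of_real pi * \<i> * of_real \<omega>)"

lemma l_power: "l ^ n = exp (\<i> * of_real (2 * pi * (n * \<omega> - m)))" for m :: int
proof -
  have "l ^ n = exp (of_nat n * (2 * of_real pi * \<i> * of_real \<omega>))"
    unfolding l_def by (rule exp_of_nat_mult[symmetric])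
  also have "\<dots> = exp (of_nat n * (2 * of_real pi * \<i> * of_real \<omega>) + (2 * of_int (- m) * pi) * \<i>)"
    by (simp add: exp_eq)
  also have "of_nat n * (2 * of_real pi * \<i> * of_real \<omega>) + (2 * of_int (- m) * pi) * \<i> =
      \<i> * of_real (2 * pi * (n * \<omega> - m))" by (simp add: algebra_simps)
  finally show ?thesis .
qed

lemma norm_l_power_minus_1: "norm (l ^ n - 1) = 2 * \<bar>sin (pi * (n * \<omega> - m))\<bar>" for m :: int
proof -
  have "2 * pi * (n * \<omega> - m) / 2 = pi * (n * \<omega> - m)" by simp
  then show ?thesis unfolding l_power[of n m] dist_exp_i_1 by simp
qed

lemma l_power_upper: "norm (l ^ n - 1) \<le> 2 * pi * \<bar>n * \<omega> - m\<bar>" for m :: int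
  unfolding norm_l_power_minus_1[of n m] using abs_sin_x_le_abs_x[of "pi * (n * \<omega> - m)"]
  by (simp add: abs_mult)

lemma l_power_lower: "\<exists>m::int. 4 * \<bar>n * \<omega> - m\<bar> \<le> norm (l ^ n - 1)"
proof
  define m where "m = round (n * \<omega>)"
  define t where "t = \<bar>n * \<omega> - m\<bar>"
  have "t \<le> 1 / 2" unfolding t_def m_def using of_int_round_abs_le[of "n * \<omega>"] by (simp add: abs_minus_commute)
  then have "pi * t \<le> pi / 2" by (simp add: field_simps)
  then have "2 * t \<le> sin (pi * t)"
    using jordan_sine[of "pi * t"] by (simp add: t_def)
  also have "\<dots> \<le> \<bar>sin (pi * (n * \<omega> - m))\<bar>"
  proof (cases "n * \<omega> - m \<ge> 0")
    case False
    then have "pi * t = - (pi * (n * \<omega> - m))" by (simp add: t_def algebra_simps)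
    then show ?thesis by (simp only: sin_minus)
  qed (simp add: t_def)
  finally show "4 * \<bar>n * \<omega> - round (n * \<omega>)\<bar> \<le> norm (l ^ n - 1)"
    unfolding norm_l_power_minus_1[of n m] t_def m_def by simp
qed

definition q :: "nat \<Rightarrow> real" where "q k = of_int (qi k)"

lemma q_0 [simp]: "q 0 = 1" and q_ge_1: "q k \<ge> 1" and q_mono: "i \<le> j \<Longrightarrow> q i \<le> q j" 
  and q_ge_index: "q k \<ge> k"
proof -
  show "q i \<le> q j" if "i \<le> j" using that
    by (rule lift_Suc_mono_le[rotated]) (simp add: q_def qi_mono_Suc)
  show "q k \<ge> k" unfolding q_def using qi_ge_index[of k] by linarith
qed (simp_all add: q_def qi_ge_1)

lemma small_at_denominator: "norm (l ^ nat (qi k) - 1) \<le> 2 * pi / q (Suc k)"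
proof -
  have "norm (l ^ nat (qi k) - 1) \<le> 2 * pi * \<bar>nat (qi k) * \<omega> - p k\<bar>" by (rule l_power_upper)
  also have "nat (qi k) * \<omega> - p k = (-1) ^ k * \<beta> k" 
    using convergent_error[of k] qi_ge_1[of k] by simp
  also have "\<bar>(-1) ^ k * \<beta> k\<bar> = \<beta> k" using \<beta>_pos[of k] by (simp add: abs_mult)
  also have "2 * pi * \<beta> k \<le> 2 * pi * (1 / q (Suc k))" unfolding q_def using \<beta>_le by (intro mult_left_mono) auto
  finally show ?thesis by simp
qed

lemma not_small_below_denominator:
  assumes "d > 0" "real d < q k / 2"
  shows "norm (l ^ d - 1) > 2 / q k"
proof -
  obtain m :: int where m: "4 * \<bar>d * \<omega> - m\<bar> \<le> norm (l ^ d - 1)" using l_power_lower by blast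
  have "2 * int d < qi k" using assms unfolding q_def by linarith
  from approximation_lower_bound[OF assms(1) this, of m]
  show ?thesis using m by (simp add: q_def)
qed

lemma norm_l: "norm l = 1"
  unfolding l_def by (simp add: mult.commute mult.left_commute norm_exp_eq_Re)

text \<open>The indices of small divisors at scale \<open>k\<close>; the threshold \<open>1 / q k\<close> is half the lower bound valid for
indices below \<open>q k / 2\<close>, which forces the gaps.\<close>

definition bad :: "nat \<Rightarrow> nat set" where "bad k = {u. u > 0 \<and> norm (l ^ u - 1) < 1 / q k}"

lemma bad_ge: assumes "u \<in> bad k" shows "u > 0" "real u \<ge> q k / 2"
proof -
  show "u > 0" using assms by (simp add: bad_def)
  show "real u \<ge> q k / 2"
  proof (rule ccontr)
    assume "\<not> ?thesis"
    then have "norm (l ^ u - 1) > 2 / q k" using \<open>u > 0\<close> by (intro not_small_below_denominator) auto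
    moreover have "2 / q k \<ge> 1 / q k" using q_ge_1[of k] by (simp add: field_simps)
    ultimately show False using assms by (simp add: bad_def)
  qed
qed

text \<open>If \<open>l ^ u\<close> and \<open>l ^ v\<close> are both close to \<open>1\<close>, then so is \<open>l ^ (v - u)\<close>.\<close>

lemma bad_gap: assumes "u \<in> bad k" "v \<in> bad k" "u < v" shows "real (v - u) \<ge> q k / 2"
proof (rule ccontr)
  assume "\<not> ?thesis"
  then have "norm (l ^ (v - u) - 1) > 2 / q k" using assms by (intro not_small_below_denominator) auto
  moreover have "norm (l ^ (v - u) - 1) = norm (l ^ u * (l ^ (v - u) - 1))"
    by (simp add: norm_mult norm_power norm_l)
  moreover have "l ^ u * (l ^ (v - u) - 1) = (l ^ v - 1) - (l ^ u - 1)"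
    using \<open>u < v\<close> by (simp add: right_diff_distrib flip: power_add)
  moreover have "norm ((l ^ v - 1) - (l ^ u - 1)) \<le> norm (l ^ v - 1) + norm (l ^ u - 1)" by (rule norm_triangle_ineq4)
  moreover have "norm (l ^ v - 1) + norm (l ^ u - 1) < 1 / q k + 1 / q k"
    using assms by (intro add_strict_mono) (auto simp: bad_def)
  moreover have "1 / q k + 1 / q k = 2 / q k" by simp
  ultimately show False by (metis less_asym less_trans le_less_trans)
qed

text \<open>A scale \<open>k\<close> that is maximal with \<open>u \<in> bad k\<close> is as required, because \<open>u\<close> is not in \<open>bad (Suc k)\<close>.
There is such a maximum, as members of \<open>bad k\<close> are at least \<open>q k / 2\<close>.\<close>

lemma small_divisor_bound:
  assumes "u > 0"
  shows "norm (l ^ u - 1) \<ge> 1 \<or> (\<exists>k. u \<in> bad k \<and> norm (l ^ u - 1) \<ge> 1 / q (Suc k))"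
proof (cases "u \<in> bad 0")
  case False then show ?thesis using assms by (simp add: bad_def)
next
  case True
  have bd: "k \<le> 2 * u" if "u \<in> bad k" for k 
    using bad_ge(2)[OF that] q_ge_index[of k] by linarith
  define k where "k = (GREATEST k. u \<in> bad k)"
  have "u \<in> bad k" unfolding k_def using True bd by (rule GreatestI_nat)
  moreover have "u \<notin> bad (Suc k)"
    using Greatest_le_nat[of "\<lambda>k. u \<in> bad k" "Suc k" "2 * u"] bd unfolding k_def by auto
  ultimately show ?thesis using assms by (auto simp: bad_def)
qed

section \<open>Accumulation of small divisors and the linearization\<close>

lemma l_power_diff: "n \<ge> 1 \<Longrightarrow> norm (l ^ n - l) = norm (l ^ (n - 1) - 1)"
proof -
  assume "n \<ge> 1"
  then have "l ^ n - l = l * (l ^ (n - 1) - 1)" by (cases n) (auto simp: algebra_simps)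
  then show ?thesis by (simp add: norm_mult norm_l)
qed

lemma l_power_neq: "n \<ge> 2 \<Longrightarrow> l ^ n \<noteq> l"
  unfolding l_def by (rule rotation_power_neq[OF irrational])

lemma ln_q_nonneg: "ln (q k) \<ge> 0" using q_ge_1[of k] by simp

text \<open>One counting function per scale, weighted by the size of the divisors of that scale. All scales
beyond \<open>2 u\<close> contribute nothing, since \<open>q k \<ge> k\<close>; so the cut-off only serves to make the sum finite
and may be raised at will.\<close>

definition K :: "nat \<Rightarrow> real" where
  "K u = (\<Sum>k\<le>2 * u. davie (q k / 2) (bad k) u * ln (q (Suc k)))"

lemma half_q_pos: "q k / 2 > 0" using q_ge_1[of k] by simp

lemma K_eq:
  assumes "N \<ge> 2 * u"
  shows "K u = (\<Sum>k\<le>N. davie (q k / 2) (bad k) u * ln (q (Suc k)))"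
  unfolding K_def
proof (rule sum.mono_neutral_left)
  show "\<forall>k\<in>{..N} - {..2 * u}. davie (q k / 2) (bad k) u * ln (q (Suc k)) = 0"
  proof
    fix k assume "k \<in> {..N} - {..2 * u}"
    then have "u < q k / 2" using q_ge_index[of k] by auto
    then show "davie (q k / 2) (bad k) u * ln (q (Suc k)) = 0" by (simp add: davie_def)
  qed
qed (use assms in auto)

lemma K_nonneg: "K u \<ge> 0"
  unfolding K_def using davie_nonneg[OF half_q_pos] ln_q_nonneg by (intro sum_nonneg mult_nonneg_nonneg)

lemma K_superadditive: "K u + K v \<le> K (u + v)"
proof -
  have "K u + K v = (\<Sum>k\<le>2 * (u + v). (davie (q k / 2) (bad k) u + davie (q k / 2) (bad k) v) * ln (q (Suc k)))"
    using K_eq[of u "2 * (u + v)"] K_eq[of v "2 * (u + v)"] by (simp add: sum.distrib distrib_right)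
  also have "\<dots> \<le> K (u + v)"
    unfolding K_def using davie_superadditive[OF half_q_pos] ln_q_nonneg by (intro sum_mono mult_right_mono)
  finally show ?thesis .
qed

text \<open>Of all scales at which \<open>u\<close> is bad, the summand of the one from \<open>small_divisor_bound\<close> already pays for the
divisor; the other summands do not decrease.\<close>

lemma K_jump:
  assumes "u > 0"
  shows "1 \<le> norm (l ^ u - 1) * exp (K u - K (u - 1))"
proof -
  define d where "d k = (davie (q k / 2) (bad k) u - davie (q k / 2) (bad k) (u - 1)) * ln (q (Suc k))" for k
  have diff: "K u - K (u - 1) = (\<Sum>k\<le>2 * u. d k)"
    unfolding d_def using K_eq[of u "2 * u"] K_eq[of "u - 1" "2 * u"] by (simp add: sum_subtractf left_diff_distrib)
  have d: "d k \<ge> 0" for k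
    unfolding d_def using davie_mono[OF half_q_pos, of "u - 1" u k "bad k"] ln_q_nonneg by (intro mult_nonneg_nonneg) auto
  from small_divisor_bound[OF assms] show ?thesis
  proof (elim disjE exE conjE)
    assume "norm (l ^ u - 1) \<ge> 1"
    moreover have "exp (K u - K (u - 1)) \<ge> 1" unfolding diff using d by (simp add: sum_nonneg)
    ultimately show ?thesis using mult_mono[of 1 "norm (l ^ u - 1)" 1 "exp (K u - K (u - 1))"] by simp
  next
    fix k assume k: "u \<in> bad k" "1 / q (Suc k) \<le> norm (l ^ u - 1)"
    have "k \<le> 2 * u" using bad_ge(2)[OF k(1)] q_ge_index[of k] by linarith
    have "1 * ln (q (Suc k)) \<le> d k"
      unfolding d_def using davie_jump[OF half_q_pos k(1) assms] bad_ge(2) bad_gap ln_q_nonneg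
      by (intro mult_right_mono) (auto simp: algebra_simps)
    also have "d k \<le> K u - K (u - 1)" unfolding diff using d \<open>k \<le> 2 * u\<close> by (intro member_le_sum) auto
    finally have "q (Suc k) \<le> exp (K u - K (u - 1))"
      using q_ge_1[of "Suc k"] by (simp add: ln_ge_iff[symmetric] ln_le_cancel_iff) (metis exp_le_cancel_iff exp_ln less_le_trans zero_less_one)
    then have "1 / q (Suc k) * q (Suc k) \<le> norm (l ^ u - 1) * exp (K u - K (u - 1))"
      using k q_ge_1[of "Suc k"] by (intro mult_mono) auto
    then show ?thesis using q_ge_1[of "Suc k"] by simp
  qed
qed

lemma K_le_brjuno_sum:
  assumes "u \<ge> 1"
  shows "\<exists>m. q m \<le> 2 * u \<and> K u \<le> 4 * u * (\<Sum>i=0..m. ln (q (i + 1)) / q i)"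
proof -
  define I where "I = {k. k \<le> 2 * u \<and> q k \<le> 2 * u}"
  have I: "finite I" "0 \<in> I" using assms by (auto simp: I_def)
  define m where "m = Max I"
  have m: "m \<in> I" "\<And>k. k \<in> I \<Longrightarrow> k \<le> m" using I by (auto simp: m_def intro: Max_in)
  have "K u = (\<Sum>k\<in>I. davie (q k / 2) (bad k) u * ln (q (Suc k)))"
    unfolding K_def by (rule sum.mono_neutral_right) (auto simp: I_def davie_def)
  also have "\<dots> \<le> (\<Sum>k\<in>I. 2 * u / (q k / 2) * ln (q (Suc k)))"
    using davie_le[OF half_q_pos] ln_q_nonneg by (intro sum_mono mult_right_mono) auto
  also have "\<dots> \<le> (\<Sum>k=0..m. 2 * u / (q k / 2) * ln (q (Suc k)))"
    using m ln_q_nonneg less_imp_le[OF half_q_pos] by (intro sum_mono2) (auto intro!: mult_nonneg_nonneg divide_nonneg_nonneg)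
  also have "\<dots> = 4 * u * (\<Sum>i=0..m. ln (q (i + 1)) / q i)"
    by (simp add: sum_distrib_left mult_ac)
  finally show ?thesis using m(1) by (auto simp: I_def)
qed

text \<open>The Brjuno sum up to the last scale \<open>m\<close> that is relevant for \<open>u\<close> is \<open>o (ln (q m))\<close> by hypothesis, and
\<open>q m \<le> 2 u\<close>.\<close>

lemma K_subfactorial:
  assumes lim: "(\<lambda>k. 1 / ln (q k) * (\<Sum>i=0..k. ln (q (i + 1)) / q i)) \<longlonglongrightarrow> 0" and "\<epsilon> > 0"
  shows "\<exists>C. \<forall>u\<ge>1. K u \<le> u * (C + \<epsilon> * ln u)"
proof -
  define B where "B k = (\<Sum>i=0..k. ln (q (i + 1)) / q i)" for k
  have term_nonneg: "ln (q (i + 1)) / q i \<ge> 0" for i using ln_q_nonneg q_ge_1[of i] by simp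
  have B_mono: "B i \<le> B j" if "i \<le> j" for i j
    unfolding B_def using that term_nonneg by (intro sum_mono2) auto
  have B_nonneg: "B i \<ge> 0" for i unfolding B_def using term_nonneg by (intro sum_nonneg) auto
  obtain k0 where k0: "\<And>k. k \<ge> k0 \<Longrightarrow> \<bar>1 / ln (q k) * B k\<bar> < \<epsilon> / 4"
    using LIMSEQ_D[OF lim, of "\<epsilon> / 4"] \<open>\<epsilon> > 0\<close> unfolding B_def by auto
  define k1 where "k1 = max k0 2"
  have B_le: "B m \<le> B k1 + \<epsilon> / 4 * ln (q m)" for m
  proof (cases "m \<ge> k1")
    case True
    have "q m > 1" using q_ge_index[of m] True by (simp add: k1_def)
    then have "B m \<le> \<epsilon> / 4 * ln (q m)" using k0[of m] True by (simp add: k1_def field_simps abs_if split: if_splits)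
    then show ?thesis using B_nonneg[of k1] by linarith
  next
    case False
    then have "B m \<le> B k1" by (intro B_mono) auto
    then show ?thesis using ln_q_nonneg[of m] \<open>\<epsilon> > 0\<close> by (simp add: add_increasing2)
  qed
  have "K u \<le> u * ((4 * B k1 + \<epsilon> * ln 2) + \<epsilon> * ln u)" if u: "u \<ge> 1" for u
  proof -
    obtain m where m: "q m \<le> 2 * u" "K u \<le> 4 * u * B m" using K_le_brjuno_sum[OF u] unfolding B_def by auto
    have "ln (q m) \<le> ln (2 * u)" using m(1) q_ge_1[of m] by (subst ln_le_cancel_iff) auto
    also have "\<dots> = ln 2 + ln u" using that by (simp add: ln_mult)
    finally have "B m \<le> B k1 + \<epsilon> / 4 * (ln 2 + ln u)"
      using B_le[of m] mult_left_mono[of "ln (q m)" "ln 2 + ln u" "\<epsilon> / 4"] \<open>\<epsilon> > 0\<close> by linarith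
    then have "4 * u * B m \<le> 4 * u * (B k1 + \<epsilon> / 4 * (ln 2 + ln u))" by (intro mult_left_mono) auto
    also have "\<dots> = u * ((4 * B k1 + \<epsilon> * ln 2) + \<epsilon> * ln u)" by (simp add: algebra_simps)
    finally show ?thesis using m(2) by linarith
  qed
  then show ?thesis by blast
qed

lemma linearization_in_A_class:
  assumes F: "F \<in> A_class s" "fps_nth (fps_deriv F) 0 = l" and "s > 0"
    and lim: "(\<lambda>k. 1 / ln (q k) * (\<Sum>i=0..k. ln (q (i + 1)) / q i)) \<longlonglongrightarrow> 0"
  shows "linearization F \<in> A_class s"
proof -
  define H where "H = linearization F"
  have F0: "fps_nth F 0 = 0" and F1: "fps_nth F 1 = l" using F by (auto simp: A_class_iff)
  have "is_linearization F H" unfolding H_def linearization_def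
    by (rule theI') (rule linearization_ex1[OF irrational F0 F(2)[unfolded l_def]])
  then have H: "fps_nth H 0 = 0" "fps_nth H 1 = 1"
    "\<And>n. n \<ge> 2 \<Longrightarrow> fps_nth H n = (\<Sum>i=2..n. fps_nth F i * fps_nth (H ^ i) n) / (l ^ n - l)"
    using is_linearization_iff[OF F0 F1 l_power_neq, of H] by auto
  have rec: "norm (fps_nth H n) \<le>
      exp (K (n - 1) - K (n - 2)) * (\<Sum>i=2..n. norm (fps_nth F i) * norm (fps_nth (H ^ i) n))" (is "_ \<le> _ * ?S")
    if "n \<ge> 2" for n
  proof -
    have "norm (\<Sum>i=2..n. fps_nth F i * fps_nth (H ^ i) n) \<le> ?S"
      by (rule order.trans[OF norm_sum]) (simp add: norm_mult)
    then have "norm (fps_nth H n) \<le> ?S / norm (l ^ n - l)"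
      unfolding H(3)[OF that] norm_divide by (intro divide_right_mono) auto
    also have "\<dots> = 1 / norm (l ^ n - l) * ?S" by simp
    also have "\<dots> \<le> exp (K (n - 1) - K (n - 2)) * ?S"
    proof (intro mult_right_mono)
      have "norm (l ^ n - l) > 0" using l_power_neq[OF that] by simp
      moreover have "1 \<le> norm (l ^ n - l) * exp (K (n - 1) - K (n - 2))"
        using K_jump[of "n - 1"] l_power_diff[of n] that by (simp add: numeral_2_eq_2)
      ultimately show "1 / norm (l ^ n - l) \<le> exp (K (n - 1) - K (n - 2))" by (simp add: field_simps)
    qed (auto intro!: sum_nonneg)
    finally show ?thesis .
  qed
  show ?thesis unfolding H_def[symmetric] A_class_iff
  proof (intro conjI allI impI)
    fix s' assume "s' > s"
    define \<sigma> \<epsilon> where "\<sigma> = (s + s') / 2" and "\<epsilon> = (s' - s) / 2"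
    have \<sigma>: "\<sigma> > s" "\<sigma> \<ge> 0" and \<epsilon>: "\<epsilon> > 0" and s': "\<sigma> + \<epsilon> = s'"
      using \<open>s' > s\<close> \<open>s > 0\<close> by (auto simp: \<sigma>_def \<epsilon>_def field_simps)
    obtain c1 c2 where c: "c1 > 0" "c2 > 0"
      "\<And>n. n \<ge> 1 \<Longrightarrow> norm (fps_nth F n) \<le> c1 * c2 ^ n * fact n powr \<sigma>"
      using F(1) \<sigma>(1) unfolding A_class_iff by blast
    obtain R where R: "R > 0" "\<And>n. norm (fps_nth H n) \<le> R ^ n * fact n powr \<sigma> * exp (K (n - 1))"
      using siegel_majorant[of H \<sigma> K c1 c2 "fps_nth F", OF H(1) _ \<sigma>(2) K_nonneg K_superadditive c rec] H(2) by auto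
    obtain C where C: "\<And>u. u \<ge> 1 \<Longrightarrow> K u \<le> u * (C + \<epsilon> * ln u)" using K_subfactorial[OF lim \<epsilon>] by blast
    have "norm (fps_nth H n) \<le> 1 * (R * exp (C + \<epsilon>)) ^ n * fact n powr s'" if n: "n \<ge> 1" for n
    proof -
      have "K (n - 1) \<le> n * (C + \<epsilon> * ln n)"
        using K_superadditive[of "n - 1" 1] K_nonneg[of 1] C[OF n] n by simp
      then have "exp (K (n - 1)) \<le> exp (C + \<epsilon>) ^ n * fact n powr \<epsilon>"
        using exp_n_ln_n_le_fact_powr[of \<epsilon> n C] \<epsilon> by (meson exp_le_cancel_iff less_imp_le order.trans)
      then have "norm (fps_nth H n) \<le> R ^ n * fact n powr \<sigma> * (exp (C + \<epsilon>) ^ n * fact n powr \<epsilon>)"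
        using R(2)[of n] R(1) by (meson less_imp_le mult_left_mono mult_nonneg_nonneg order.trans powr_ge_zero zero_le_power)
      also have "\<dots> = 1 * (R * exp (C + \<epsilon>)) ^ n * (fact n powr \<sigma> * fact n powr \<epsilon>)"
        by (simp add: power_mult_distrib mult_ac)
      finally show ?thesis unfolding powr_add[symmetric] s' .
    qed
    then show "\<exists>c1>0. \<exists>c2>0. \<forall>n\<ge>1. norm (fps_nth H n) \<le> c1 * c2 ^ n * fact n powr s'"
      using R(1) by (intro gevrey_boundI[of 1 "R * exp (C + \<epsilon>)"]) auto
  qed (rule H(1))
qed

section \<open>Invertibility of the operator\<close>

text \<open>A divisor at a bad index \<open>n\<close> of scale \<open>k\<close> costs \<open>ln (q (Suc k)) \<le> \<epsilon> q k ln (q k)\<close>, and \<open>q k \<le> 2 n\<close>.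
Finitely many scales escape this estimate and are absorbed by \<open>C\<close>.\<close>

lemma small_divisors_subfactorial:
  assumes lim: "(\<lambda>k. ln (q (k + 1)) / (q k * ln (q k))) \<longlonglongrightarrow> 0" and "\<epsilon> > 0"
  shows "\<exists>C. \<forall>n\<ge>1. 1 \<le> norm (l ^ n - 1) * exp (n * (C + \<epsilon> * ln n))"
proof -
  obtain k0 where k0: "\<And>k. k \<ge> k0 \<Longrightarrow> \<bar>ln (q (k + 1)) / (q k * ln (q k))\<bar> < \<epsilon> / 2"
    using LIMSEQ_D[OF lim, of "\<epsilon> / 2"] \<open>\<epsilon> > 0\<close> by auto
  define k1 where "k1 = max k0 2"
  define C where "C = ln (q k1) + \<epsilon> * ln 2"
  have C: "C \<ge> 0" using ln_q_nonneg \<open>\<epsilon> > 0\<close> by (simp add: C_def)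
  have "1 \<le> norm (l ^ n - 1) * exp (n * (C + \<epsilon> * ln n))" if n: "n \<ge> 1" for n
  proof -
    have exp_ge: "exp (n * (C + \<epsilon> * ln n)) \<ge> 1"
      using C \<open>\<epsilon> > 0\<close> n by simp
    have "n > 0" using n by simp
    from small_divisor_bound[OF this] show ?thesis
    proof (elim disjE exE conjE)
      assume "norm (l ^ n - 1) \<ge> 1"
      then show ?thesis using exp_ge mult_mono[of 1 "norm (l ^ n - 1)" 1 "exp (n * (C + \<epsilon> * ln n))"] by simp
    next
      fix k assume k: "n \<in> bad k" "1 / q (Suc k) \<le> norm (l ^ n - 1)"
      have "ln (q (Suc k)) \<le> n * (C + \<epsilon> * ln n)"
      proof (cases "k < k1")
        case True
        then have "ln (q (Suc k)) \<le> ln (q k1)"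
          using q_mono[of "Suc k" k1] q_ge_1[of "Suc k"] by (subst ln_le_cancel_iff) auto
        also have "\<dots> \<le> 1 * (C + \<epsilon> * ln n)" using n \<open>\<epsilon> > 0\<close> by (simp add: C_def)
        also have "\<dots> \<le> n * (C + \<epsilon> * ln n)" using n C \<open>\<epsilon> > 0\<close> by (intro mult_right_mono) auto
        finally show ?thesis .
      next
        case False
        then have "k0 \<le> k" "q k > 1" using q_ge_index[of k] by (simp_all add: k1_def)
        then have "ln (q (k + 1)) \<le> \<epsilon> / 2 * (q k * ln (q k))"
          using k0[of k] ln_q_nonneg[of "k + 1"] by (simp add: field_simps)
        also have "\<dots> \<le> \<epsilon> / 2 * (2 * n * ln (2 * n))"
          using bad_ge(2)[OF k(1)] \<open>q k > 1\<close> \<open>\<epsilon> > 0\<close> n by (intro mult_left_mono mult_mono) auto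
        also have "\<dots> = n * (\<epsilon> * ln 2 + \<epsilon> * ln n)" using n by (simp add: ln_mult algebra_simps)
        also have "\<dots> \<le> n * (C + \<epsilon> * ln n)" using ln_q_nonneg by (intro mult_left_mono) (auto simp: C_def)
        finally show ?thesis by simp
      qed
      then have "q (Suc k) \<le> exp (n * (C + \<epsilon> * ln n))"
        using q_ge_1[of "Suc k"] by (metis exp_le_cancel_iff exp_ln less_le_trans zero_less_one)
      then have "1 / q (Suc k) * q (Suc k) \<le> norm (l ^ n - 1) * exp (n * (C + \<epsilon> * ln n))"
        using k q_ge_1[of "Suc k"] by (intro mult_mono) auto
      then show ?thesis using q_ge_1[of "Suc k"] by simp
    qed
  qed
  then show ?thesis by blast
qed

lemma inj_on_delta_op: "inj_on (delta_op l) (zA_class s)"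
proof (rule inj_onI)
  fix f g assume fg: "f \<in> zA_class s" "g \<in> zA_class s" "delta_op l f = delta_op l g"
  have "fps_nth f n = fps_nth g n" for n
  proof (cases "n \<ge> 2")
    case True
    have "fps_nth (delta_op l f) n = fps_nth (delta_op l g) n" using fg(3) by simp
    then show ?thesis using True l_power_neq[of n] by (simp add: delta_op_def)
  next
    case False
    have "fps_nth h n = 0" if "h \<in> zA_class s" for h
      using that False by (cases n) (auto simp: zA_class_def A_class_iff Suc_le_eq)
    then show ?thesis using fg by simp
  qed
  then show "f = g" by (simp add: fps_eq_iff)
qed

lemma automorphism_if_small_divisors:
  assumes lim: "(\<lambda>k. ln (q (k + 1)) / (q k * ln (q k))) \<longlonglongrightarrow> 0"
  shows "linear_automorphism_on (delta_op l) (zA_class s)"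
proof -
  have lin: "acts_linearly_on (delta_op l) (zA_class s)" by (rule acts_linearly_on_delta_op) (simp add: norm_l)
  have "zA_class s \<subseteq> delta_op l ` zA_class s"
  proof
    fix f assume "f \<in> zA_class s"
    then obtain g where g: "g \<in> A_class s" "f = fps_X * g" by (auto simp: zA_class_def)
    have g0: "fps_nth g 0 = 0" using g by (simp add: A_class_iff)
    define h where "h = Abs_fps (\<lambda>n. fps_nth g n / (l ^ Suc n - l))"
    have "h \<in> A_class s"
    proof (rule A_class_mult_subfactorial[OF g(1)])
      fix \<epsilon> :: real assume "\<epsilon> > 0"
      from small_divisors_subfactorial[OF lim this] obtain C where
        C: "\<And>n. n \<ge> 1 \<Longrightarrow> 1 \<le> norm (l ^ n - 1) * exp (n * (C + \<epsilon> * ln n))" by blast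
      have "norm (fps_nth h n) \<le> norm (fps_nth g n) * exp (n * (C + \<epsilon> * ln n))" if n: "n \<ge> 1" for n
      proof -
        have eq: "norm (l ^ Suc n - l) = norm (l ^ n - 1)" using l_power_diff[of "Suc n"] by simp
        have pos: "norm (l ^ Suc n - l) > 0" using l_power_neq[of "Suc n"] n by simp
        have "norm (fps_nth g n) * 1 \<le> norm (fps_nth g n) * (norm (l ^ n - 1) * exp (n * (C + \<epsilon> * ln n)))"
          using C[OF n] by (intro mult_left_mono) auto
        then have "norm (fps_nth g n) / norm (l ^ Suc n - l) \<le> norm (fps_nth g n) * exp (n * (C + \<epsilon> * ln n))"
          using pos unfolding eq by (simp add: field_simps)
        then show ?thesis by (simp add: h_def norm_divide del: power_Suc)
      qed
      then show "\<exists>C. \<forall>n\<ge>1. norm (fps_nth h n) \<le> norm (fps_nth g n) * exp (n * (C + \<epsilon> * ln n))" by blast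
    qed (simp add: h_def g0)
    moreover have "delta_op l (fps_X * h) = f"
    proof -
      have "Abs_fps (\<lambda>n. (l ^ Suc n - l) * fps_nth h n) = g"
        unfolding fps_eq_iff
      proof
        fix n show "fps_nth (Abs_fps (\<lambda>n. (l ^ Suc n - l) * fps_nth h n)) n = fps_nth g n"
          using l_power_neq[of "Suc n"] g0 by (cases n) (auto simp: h_def simp del: power_Suc)
      qed
      then show ?thesis using g g0 by (subst delta_op_fps_X_mult) (auto simp: h_def simp del: power_Suc)
    qed
    ultimately show "f \<in> delta_op l ` zA_class s" by (force simp: zA_class_def)
  qed
  then show ?thesis using lin inj_on_delta_op
    by (auto simp: linear_automorphism_on_def bij_betw_def acts_linearly_on_def)
qed

text \<open>Test surjectivity on the series with coefficients \<open>(n!)\<^bsup>s\<^esup>\<close>, the borderline case of the class: its preimage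
again lies in the class, so \<open>1 / norm (l ^ n - 1)\<close> is at most \<open>c1 c2\<^bsup>n\<^esup> (n!)\<^bsup>\<epsilon>\<^esup>\<close>. At
\<open>n = q k\<close> the left-hand side is at least a constant times \<open>q (Suc k)\<close>.\<close>

lemma small_divisors_if_automorphism:
  assumes "linear_automorphism_on (delta_op l) (zA_class s)" "s > 0"
  shows "(\<lambda>k. ln (q (k + 1)) / (q k * ln (q k))) \<longlonglongrightarrow> 0"
proof -
  define g where "g = Abs_fps (\<lambda>n. if n = 0 then 0 else complex_of_real (fact n powr s))"
  have "g \<in> A_class s"
    unfolding A_class_iff
  proof (intro conjI allI impI)
    fix s' assume "s' > s"
    then have "\<forall>n\<ge>1. norm (fps_nth g n) \<le> 1 * 1 ^ n * fact n powr s'"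
      by (auto simp: g_def intro!: powr_mono)
    then show "\<exists>c1>0. \<exists>c2>0. \<forall>n\<ge>1. norm (fps_nth g n) \<le> c1 * c2 ^ n * fact n powr s'"
      by (intro gevrey_boundI[of 1 1]) auto
  qed (simp add: g_def)
  then have "fps_X * g \<in> delta_op l ` zA_class s"
    using assms by (auto simp: linear_automorphism_on_def bij_betw_def zA_class_def)
  then obtain h where h: "h \<in> A_class s" "delta_op l (fps_X * h) = fps_X * g" by (auto simp: zA_class_def)
  have h_nth: "norm (l ^ n - 1) * norm (fps_nth h n) = fact n powr s" if "n \<ge> 1" for n
  proof -
    have "fps_nth (delta_op l (fps_X * h)) (Suc n) = fps_nth (fps_X * g) (Suc n)" by (simp add: h)
    then have "norm ((l ^ Suc n - l) * fps_nth h n) = norm (complex_of_real (fact n powr s))"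
      using that by (simp add: delta_op_def g_def del: power_Suc)
    then show ?thesis using l_power_diff[of "Suc n"] by (simp add: norm_mult del: power_Suc)
  qed
  have ln_q_lim: "filterlim (\<lambda>k. ln (q k)) at_top sequentially"
    by (rule filterlim_compose[OF ln_at_top], rule filterlim_at_top_mono[OF filterlim_real_sequentially])
       (simp add: q_ge_index)
  have nonneg: "ln (q (k + 1)) / (q k * ln (q k)) \<ge> 0" for k
    using ln_q_nonneg q_ge_1[of k] by (intro divide_nonneg_nonneg mult_nonneg_nonneg) auto
  show ?thesis
  proof (rule LIMSEQ_I)
    fix e :: real assume "e > 0"
    define \<epsilon> where "\<epsilon> = e / 2"
    have "\<epsilon> > 0" using \<open>e > 0\<close> by (simp add: \<epsilon>_def)
    then obtain c1 c2 where c: "c1 > 0" "c2 > 0"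
      "\<And>n. n \<ge> 1 \<Longrightarrow> norm (fps_nth h n) \<le> c1 * c2 ^ n * fact n powr (s + \<epsilon>)"
      using h(1) unfolding A_class_iff by (metis less_add_same_cancel1)
    define M where "M = \<bar>ln (2 * pi * c1)\<bar> + \<bar>ln c2\<bar>"
    have "M \<ge> 0" by (simp add: M_def)
    have bound: "ln (q (k + 1)) \<le> q k * M + \<epsilon> * (q k * ln (q k))" for k
    proof -
      define n where "n = nat (qi k)"
      define Y where "Y = 2 * pi * c1 * c2 ^ n * fact n powr \<epsilon> / q (Suc k)"
      have n: "real n = q k" "n \<ge> 1" using qi_ge_1[of k] by (auto simp: n_def q_def)
      have "fact n powr s \<le> norm (l ^ n - 1) * (c1 * c2 ^ n * fact n powr (s + \<epsilon>))"
        using h_nth[OF n(2)] c(3)[OF n(2)] by (metis mult_left_mono norm_ge_zero)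
      also have "\<dots> \<le> 2 * pi / q (Suc k) * (c1 * c2 ^ n * fact n powr (s + \<epsilon>))"
        using small_at_denominator[of k] c by (intro mult_right_mono) (auto simp: n_def)
      also have "\<dots> = fact n powr s * Y" by (simp add: powr_add Y_def)
      finally have "1 \<le> 2 * pi * c1 * c2 ^ n * fact n powr \<epsilon> / q (Suc k)" unfolding Y_def[symmetric] by simp
      then have "q (Suc k) \<le> 2 * pi * c1 * c2 ^ n * fact n powr \<epsilon>"
        using q_ge_1[of "Suc k"] by (simp add: field_simps)
      then have "ln (q (Suc k)) \<le> ln (2 * pi * c1 * c2 ^ n * fact n powr \<epsilon>)"
        using q_ge_1[of "Suc k"] c by (subst ln_le_cancel_iff) auto
      also have "\<dots> = ln (2 * pi * c1) + n * ln c2 + \<epsilon> * ln (fact n)"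
        using c by (simp add: ln_mult ln_realpow ln_powr)
      also have "\<dots> \<le> n * \<bar>ln (2 * pi * c1)\<bar> + n * \<bar>ln c2\<bar> + \<epsilon> * (n * ln n)"
      proof (intro add_mono mult_left_mono)
        have "1 * \<bar>ln (2 * pi * c1)\<bar> \<le> n * \<bar>ln (2 * pi * c1)\<bar>" using n by (intro mult_right_mono) auto
        then show "ln (2 * pi * c1) \<le> n * \<bar>ln (2 * pi * c1)\<bar>" by linarith
        have "ln (fact n) \<le> ln (real n ^ n)"
          using fact_le_power[of n, where 'a = real] n by (subst ln_le_cancel_iff) auto
        then show "ln (fact n) \<le> n * ln (real n)" using n by (simp add: ln_realpow)
      qed (use \<open>\<epsilon> > 0\<close> in auto)
      finally show ?thesis by (simp add: n M_def algebra_simps)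
    qed
    have "eventually (\<lambda>k. ln (q k) > 2 * M / e) sequentially"
      using ln_q_lim by (simp add: filterlim_at_top_dense)
    then obtain k0 where k0: "\<And>k. k \<ge> k0 \<Longrightarrow> ln (q k) > 2 * M / e" by (auto simp: eventually_sequentially)
    have "norm (ln (q (k + 1)) / (q k * ln (q k)) - 0) < e" if "k \<ge> k0" for k
    proof -
      have pos: "ln (q k) > 0" using k0[OF that] \<open>M \<ge> 0\<close> \<open>e > 0\<close> by (smt (verit) divide_nonneg_pos)
      have "M < e / 2 * ln (q k)" using k0[OF that] \<open>e > 0\<close> by (simp add: field_simps)
      then have "q k * M < q k * (e / 2 * ln (q k))" using q_ge_1[of k] by (intro mult_strict_left_mono) auto
      then have "ln (q (k + 1)) < e * (q k * ln (q k))"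
        using bound[of k] by (simp add: \<epsilon>_def algebra_simps)
      then have "ln (q (k + 1)) / (q k * ln (q k)) < e"
        using pos q_ge_1[of k] by (subst pos_divide_less_eq) auto
      then show ?thesis using nonneg[of k] by simp
    qed
    then show "\<exists>no. \<forall>k\<ge>no. norm (ln (q (k + 1)) / (q k * ln (q k)) - 0) < e" by blast
  qed
qed

end

theorem mainTheorem3:
  fixes s \<omega> :: real and l :: complex and q :: "nat \<Rightarrow> real"
  assumes "s > 0" and "\<omega> \<notin> \<rat>"
    and "l = exp (2 * of_real pi * \<i> * of_real \<omega>)"
    and "\<And>k. q k = of_int (cf_denom \<omega> k)"
  shows "acts_linearly_on (delta_op l) (zA_class s) \<and>
    (linear_automorphism_on (delta_op l) (zA_class s) \<longleftrightarrow>
       (\<lambda>k. ln (q (k + 1)) / (q k * ln (q k))) \<longlonglongrightarrow> 0) \<and>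
    (\<forall>F \<in> A_class s. fps_nth (fps_deriv F) 0 = l \<longrightarrow>
       (\<lambda>k. 1 / ln (q k) * (\<Sum>i=0..k. ln (q (i + 1)) / q i)) \<longlonglongrightarrow> 0 \<longrightarrow>
       linearization F \<in> A_class s)"
proof -
  interpret R: irrational_rotation \<omega> by unfold_locales (rule assms(2))
  have l: "l = R.l" using assms(3) by (simp add: R.l_def)
  have q: "q = R.q" using assms(4) by (simp add: fun_eq_iff R.q_def R.qi_def)
  show ?thesis unfolding l q
    using acts_linearly_on_delta_op[of R.l s] R.norm_l R.automorphism_if_small_divisors[of s]
      R.small_divisors_if_automorphism[of s] R.linearization_in_A_class[of _ s] assms(1) by auto
qed

end
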